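(* (Overfull Conjecture for split-comparability graphs.) Let $G$ be a split-comparability graph on $n$ vertices whose vertex set is partitioned as $V(G) = Q \cup S$, where $Q$ is a maximal clique, $S$ is a stable set, and both $Q$ and $S$ are non-empty. If $\Delta(G) > n/3$, then $G$ is Class 2 (that is, $\chi'(G)=\Delta(G)+1$) if and only if $G$ is subgraph-overfull.
   Context: All graphs are finite, simple and undirected. $\Delta(G)$ denotes the maximum degree of $G$. The chromatic index $\chi'(G)$ is the least $k$ such that the edges of $G$ can be colored with $k$ colors so that adjacent edges receive distinct colors. By Vizing's theorem $\chi'(G) \in \{\Delta(G), \Delta(G)+1\}$; $G$ is Class 1 if $\chi'(G)=\Delta(G)$ and Class 2 if $\chi'(G)=\Delta(G)+1$. A graph $H$ with $n_H$ vertices and $m_H$ edges is overfull if $n_H$ is odd and $m_H > (n_H-1)\Delta(H)/2$. A graph $G$ is subgraph-overfull if it has a subgraph $H$ with $\Delta(H)=\Delta(G)$ such that $H$ is overfull. A clique is a set of pairwise adjacent vertices; it is maximal if no other clique contains it. A stable set is a set of pairwise non-adjacent vertices. A graph is a split graph if its vertex set can be partitioned into a clique $Q$ and a stable set $S$. A graph is a comparability graph if its edges admit a transitive orientation, i.e. an orientation such that whenever the directed edges $(x,y)$ and $(y,z)$ exist, so does $(x,z)$. A split-comparability graph is a graph that is both a split graph and a comparability graph. *)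

theory Defs
  imports Complex_Main "HOL-Library.Ramsey"
begin

text \<open>
  A graph is given by its vertex set \<open>V\<close> and its edge set \<open>E\<close>, where \<open>E\<close> consists of two-element
  subsets of \<open>V\<close>. Cliques and stable sets are \<^const>\<open>clique\<close> and \<^const>\<open>indep\<close> from
  \<^theory>\<open>HOL-Library.Ramsey\<close>; both take the vertex subset first and the edge set second, and
  neither requires that subset to lie in \<open>V\<close>.
\<close>

definition simple_graph :: "'a set \<Rightarrow> 'a set set \<Rightarrow> bool" where
  "simple_graph V E \<longleftrightarrow> finite V \<and> E \<subseteq> [V]\<^bsup>2\<^esup>"

definition subgraph :: "'a set \<Rightarrow> 'a set set \<Rightarrow> 'a set \<Rightarrow> 'a set set \<Rightarrow> bool" where
  "subgraph W F V E \<longleftrightarrow> simple_graph W F \<and> W \<subseteq> V \<and> F \<subseteq> E"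

definition degree :: "'a set set \<Rightarrow> 'a \<Rightarrow> nat" where
  "degree E v = card {e \<in> E. v \<in> e}"

text \<open>Only meaningful for finite non-empty \<open>V\<close>.\<close>

definition max_degree :: "'a set \<Rightarrow> 'a set set \<Rightarrow> nat" where
  "max_degree V E = Max (degree E ` V)"

definition proper_edge_colouring :: "'a set set \<Rightarrow> nat \<Rightarrow> ('a set \<Rightarrow> nat) \<Rightarrow> bool" where
  "proper_edge_colouring E k c \<longleftrightarrow>
     c ` E \<subseteq> {..<k} \<and> (\<forall>e\<in>E. \<forall>f\<in>E. e \<noteq> f \<and> e \<inter> f \<noteq> {} \<longrightarrow> c e \<noteq> c f)"

definition chromatic_index :: "'a set set \<Rightarrow> nat" where
  "chromatic_index E = (LEAST k. \<exists>c. proper_edge_colouring E k c)"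

definition class_2 :: "'a set \<Rightarrow> 'a set set \<Rightarrow> bool" where
  "class_2 V E \<longleftrightarrow> chromatic_index E = max_degree V E + 1"

definition overfull :: "'a set \<Rightarrow> 'a set set \<Rightarrow> bool" where
  "overfull V E \<longleftrightarrow>
     odd (card V) \<and> real (card E) > (real (card V) - 1) * real (max_degree V E) / 2"

definition subgraph_overfull :: "'a set \<Rightarrow> 'a set set \<Rightarrow> bool" where
  "subgraph_overfull V E \<longleftrightarrow>
     (\<exists>W F. subgraph W F V E \<and> max_degree W F = max_degree V E \<and> overfull W F)"

definition maximal_clique :: "'a set \<Rightarrow> 'a set \<Rightarrow> 'a set set \<Rightarrow> bool" where
  "maximal_clique Q V E \<longleftrightarrow>
     Q \<subseteq> V \<and> clique Q E \<and> \<not> (\<exists>R. R \<subseteq> V \<and> clique R E \<and> Q \<subset> R)"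

definition split_graph :: "'a set \<Rightarrow> 'a set set \<Rightarrow> bool" where
  "split_graph V E \<longleftrightarrow>
     simple_graph V E \<and> (\<exists>Q S. V = Q \<union> S \<and> Q \<inter> S = {} \<and> clique Q E \<and> indep S E)"

text \<open>Each edge receives exactly one of its two directions; \<open>asym A\<close> excludes both at once.\<close>

definition orientation :: "'a set set \<Rightarrow> ('a \<times> 'a) set \<Rightarrow> bool" where
  "orientation E A \<longleftrightarrow> asym A \<and> (\<forall>x y. {x, y} \<in> E \<longleftrightarrow> (x, y) \<in> A \<or> (y, x) \<in> A)"

definition comparability_graph :: "'a set \<Rightarrow> 'a set set \<Rightarrow> bool" where
  "comparability_graph V E \<longleftrightarrow> simple_graph V E \<and> (\<exists>A. orientation E A \<and> trans A)"

definition split_comparability_graph :: "'a set \<Rightarrow> 'a set set \<Rightarrow> bool" where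
  "split_comparability_graph V E \<longleftrightarrow> split_graph V E \<and> comparability_graph V E"

end

theory Submission
  imports Defs
begin

text \<open>
Let \<open>\<Delta>\<close> be the maximum degree. An overfull subgraph of maximum degree \<open>\<Delta>\<close> has more edges than \<open>\<Delta>\<close>
  matchings can hold, so it rules out \<open>\<Delta>\<close> colours. The rest is the construction of colourings.

  A transitive orientation linearly orders the clique \<open>Q\<close>. As no vertex of \<open>Q\<close> is the middle of a
  directed path between two stable vertices, the vertices of \<open>Q\<close> with stable neighbours fall into an initial
  part \<open>L\<close> and a final part \<open>R\<close>, and the neighbourhoods of the stable vertices form a chain on \<open>L\<close> and a
  chain on \<open>R\<close> (locale \<open>two_chains\<close>). Let \<open>SL\<close> and \<open>SR\<close> consist of the stable vertices with a neighbour
  in \<open>L\<close> and in \<open>R\<close>, where by symmetry \<open>|SR| \<le> |SL|\<close>. A vertex common to all nonempty traces on \<open>L\<close> shows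
  \<open>\<Delta> = |Q| - 1 + |SL|\<close>. Mapping \<open>SR - SL\<close> injectively into \<open>SL - SR\<close> identifies only vertices
  without common neighbours, so colourings of graphs on the \<open>\<Delta> + 1\<close> vertices \<open>Q \<union> SL\<close> pull back
  (\<open>colouring_by_identification\<close>). Hence \<open>\<Delta> + 1\<close> colours always suffice, and \<open>\<Delta>\<close> colours
  suffice if \<open>\<Delta>\<close> is odd, because complete graphs of even order have 1-factorizations.

  Let \<open>\<Delta> = 2m\<close>. If the subgraph induced by \<open>Q \<union> SL\<close> is not overfull, at least \<open>m\<close> of its vertex pairs are
  not adjacent. A set \<open>B\<close> of \<open>m\<close> such pairs is deleted from the complete graph on \<open>2m + 1\<close> vertices, and
  \<open>2m\<close> colours must now leave each colour missing at exactly one vertex. It is possible to choose \<open>B\<close> so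
  that it touches at most \<open>m + 1\<close> vertices. Then the \<open>2m\<close> colours can be handed out in advance as
  missing colours, one for each incidence of a vertex with a deleted pair; a greedy colouring of the remaining
  pairs of touched vertices has enough colours, and it extends to all of the graph because each
  colour passes a simple parity and size test (\<open>tight_colouring\<close>, based on
  \<open>amalgamated_clique_colouring\<close>).

  A deleted pair \<open>{s, a}\<close> may still be the image of an edge \<open>{s', a}\<close>, where \<open>s' \<in> SR - SL\<close> is identified with
  \<open>s\<close>. That edge receives the colour that is missing at \<open>a\<close> on account of the pair. At \<open>s'\<close> the only
  possible clash is between a deleted and a kept pair, and it is avoided in one of three ways: by deleting all or
  none of the pairs that correspond to \<open>s'\<close>; by permuting \<open>Q\<close>
  (\<open>colouring_one_stable_vertex\<close>); or, for at most one stable vertex, by an additional restriction on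
  the greedy colouring. These suffice when the neighbourhoods are moderate
  or when those on \<open>L\<close> are large; when those on \<open>R\<close> are large, either some vertex of \<open>SL\<close>
  represents no other vertex and can lose all pairs at once, or \<open>|SL| = |SR|\<close> and the
  roles of \<open>L\<close> and \<open>R\<close> are exchanged (\<open>colouring_even_degree\<close>).
\<close>

section \<open>Bipartite matchings covering all vertices of full degree\<close>

text \<open>
  Hall's theorem, by induction on the index set: either some proper subfamily is tight, and the family
  splits along it, or one index may take an arbitrary element.
\<close>
lemma hall:
  fixes A :: "'i \<Rightarrow> 'c set"
  assumes "finite I" and "\<And>i. i \<in> I \<Longrightarrow> finite (A i)"
    and "\<And>J. J \<subseteq> I \<Longrightarrow> card J \<le> card (\<Union>(A ` J))"
  shows "\<exists>f. inj_on f I \<and> (\<forall>i\<in>I. f i \<in> A i)"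
  using assms
proof (induction "card I" arbitrary: I A rule: less_induct)
  case less
  note hallc = less.prems(3)
  show ?case
  proof (cases "I = {}")
    case True then show ?thesis by simp
  next
    case False
    show ?thesis
    proof (cases "\<exists>J. J \<subset> I \<and> J \<noteq> {} \<and> card (\<Union>(A ` J)) \<le> card J")
      case True
      then obtain J where J: "J \<subset> I" "J \<noteq> {}" "card (\<Union>(A ` J)) \<le> card J" by blast
      let ?X = "\<Union>(A ` J)"
      have finJ: "finite J" using J less.prems(1) finite_subset by blast
      have finX: "finite ?X" using finJ J less.prems(2) by blast
      have "card J < card I" using J less.prems(1) by (simp add: psubset_card_mono)
      then obtain f where f: "inj_on f J" "\<forall>i\<in>J. f i \<in> A i"
        using less.hyps[of J A, OF _ finJ] J less.prems(2) hallc by (meson psubsetD psubset_imp_subset subset_trans)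
      have "\<exists>g. inj_on g (I - J) \<and> (\<forall>i\<in>I - J. g i \<in> A i - ?X)"
      proof (rule less.hyps)
        show "card (I - J) < card I"
          using J less.prems(1) by (intro psubset_card_mono) auto
        fix K assume K: "K \<subseteq> I - J"
        have finK: "finite K" using K less.prems(1) finite_subset by blast
        have "card K + card J = card (K \<union> J)"
          using K finK finJ by (subst card_Un_disjoint) auto
        also have "\<dots> \<le> card (\<Union>(A ` (K \<union> J)))" using K J by (intro hallc) auto
        also have "\<Union>(A ` (K \<union> J)) = \<Union>((\<lambda>i. A i - ?X) ` K) \<union> ?X" by auto
        also have "card \<dots> \<le> card (\<Union>((\<lambda>i. A i - ?X) ` K)) + card ?X" by (rule card_Un_le)
        finally show "card K \<le> card (\<Union>((\<lambda>i. A i - ?X) ` K))" using J(3) by linarith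
      qed (use less.prems in auto)
      then obtain g where g: "inj_on g (I - J)" "\<forall>i\<in>I - J. g i \<in> A i - ?X" by blast
      let ?h = "\<lambda>i. if i \<in> J then f i else g i"
      have "inj_on ?h I"
        unfolding inj_on_def
      proof (intro ballI impI)
        fix i j assume ij: "i \<in> I" "j \<in> I" "?h i = ?h j"
        consider "i \<in> J" "j \<in> J" | "i \<in> J" "j \<notin> J" | "i \<notin> J" "j \<in> J" | "i \<notin> J" "j \<notin> J" by blast
        then show "i = j"
        proof cases
          case 1 then show ?thesis using ij f(1) by (simp add: inj_on_eq_iff)
        next
          case 2
          then have "f i = g j" using ij by simp
          moreover have "f i \<in> ?X" using 2 f(2) by blast
          moreover have "g j \<notin> ?X" using 2 ij g(2) by blast
          ultimately show ?thesis by simp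
        next
          case 3
          then have "g i = f j" using ij by simp
          moreover have "f j \<in> ?X" using 3 f(2) by blast
          moreover have "g i \<notin> ?X" using 3 ij g(2) by blast
          ultimately show ?thesis by simp
        next
          case 4 then show ?thesis using ij g(1) by (simp add: inj_on_eq_iff)
        qed
      qed
      moreover have "\<forall>i\<in>I. ?h i \<in> A i" using f g by auto
      ultimately show ?thesis by blast
    next
      case strict: False
      obtain i where i: "i \<in> I" using False by blast
      have "card {i} \<le> card (\<Union>(A ` {i}))" using i by (intro hallc) auto
      then obtain x where x: "x \<in> A i" by fastforce
      have "\<exists>g. inj_on g (I - {i}) \<and> (\<forall>j\<in>I - {i}. g j \<in> A j - {x})"
      proof (rule less.hyps)
        show "card (I - {i}) < card I" using i less.prems(1) by (simp only: card_Diff1_less)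
        fix K assume K: "K \<subseteq> I - {i}"
        show "card K \<le> card (\<Union>((\<lambda>j. A j - {x}) ` K))"
        proof (cases "K = {}")
          case False
          have "K \<subset> I" using K i by blast
          then have "card K < card (\<Union>(A ` K))" using strict False by (meson not_le)
          moreover have eq: "\<Union>((\<lambda>j. A j - {x}) ` K) = \<Union>(A ` K) - {x}" by auto
          moreover have "card (\<Union>(A ` K)) - 1 \<le> card (\<Union>(A ` K) - {x})"
            by (metis card_Diff_singleton_if diff_le_self order_refl)
          ultimately show ?thesis unfolding eq by linarith
        qed simp
      qed (use less.prems in auto)
      then obtain g where g: "inj_on g (I - {i})" "\<forall>j\<in>I - {i}. g j \<in> A j - {x}" by blast
      have "inj_on (g(i := x)) I"
        using g unfolding inj_on_def by (metis DiffE DiffI fun_upd_apply insertCI singletonD)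
      moreover have "\<forall>j\<in>I. (g(i := x)) j \<in> A j" using g x by auto
      ultimately show ?thesis by blast
    qed
  qed
qed

text \<open>
  Counting incidences in two ways: the sets of a subfamily \<open>J\<close> have \<open>p * card J\<close> incidences,
  and no element absorbs more than \<open>p\<close> of them.
\<close>
lemma regular_sdr:
  fixes A :: "'i \<Rightarrow> 'c set"
  assumes "finite I" "0 < p" "\<And>i. i \<in> I \<Longrightarrow> card (A i) = p"
    and "\<And>c. card {i \<in> I. c \<in> A i} \<le> p"
  shows "\<exists>f. inj_on f I \<and> (\<forall>i\<in>I. f i \<in> A i)"
proof (rule hall)
  show fin: "finite (A i)" if "i \<in> I" for i using assms(2,3) that card_gt_0_iff by metis
  fix J assume J: "J \<subseteq> I"
  then have finJ: "finite J" using assms(1) finite_subset by blast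
  let ?X = "\<Union>(A ` J)"
  have finX: "finite ?X" using finJ J fin by blast
  have "p * card J = (\<Sum>i\<in>J. card {c \<in> ?X. c \<in> A i})"
  proof -
    have "card {c \<in> ?X. c \<in> A i} = p" if "i \<in> J" for i
    proof -
      have "{c \<in> ?X. c \<in> A i} = A i" using that by blast
      then show ?thesis using assms(3) J that by auto
    qed
    then show ?thesis by simp
  qed
  also have "\<dots> = (\<Sum>c\<in>?X. card {i \<in> J. c \<in> A i})"
    using sum_multicount_gen[OF finJ finX, of "\<lambda>i c. c \<in> A i" "\<lambda>c. card {i \<in> J. c \<in> A i}"] by simp
  also have "\<dots> \<le> (\<Sum>c\<in>?X. p)"
  proof (rule sum_mono)
    fix c
    have "card {i \<in> J. c \<in> A i} \<le> card {i \<in> I. c \<in> A i}"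
      using J assms(1) by (intro card_mono) auto
    then show "card {i \<in> J. c \<in> A i} \<le> p" using assms(4) le_trans by blast
  qed
  finally show "card J \<le> card ?X" using assms(2) by simp
qed (rule assms(1))

text \<open>
  Two matchings, one saturating \<open>W\<close> and one saturating \<open>D\<close>, merge into one that saturates both.
  As in the proof of the Cantor-Schroeder-Bernstein theorem, \<open>g\<close> is used on the alternating
  paths that start at elements of \<open>D\<close> not reached by \<open>f\<close>, and \<open>f\<close> elsewhere.
\<close>
lemma mendelsohn_dulmage:
  assumes f: "inj_on f W" "\<And>w. w \<in> W \<Longrightarrow> f w \<in> A w"
    and g: "inj_on g D" "\<And>c. c \<in> D \<Longrightarrow> g c \<in> W \<and> c \<in> A (g c)"
  shows "\<exists>h. inj_on h W \<and> (\<forall>w\<in>W. h w \<in> A w) \<and> D \<subseteq> h ` W"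
proof -
  define I where "I = lfp (\<lambda>X. g ` (D - f ` W) \<union> g ` (D \<inter> f ` X))"
  have I: "I = g ` (D - f ` W) \<union> g ` (D \<inter> f ` I)"
    unfolding I_def by (rule lfp_unfold) (auto simp: mono_def)
  have ID: "I \<subseteq> g ` D" by (subst I) blast
  have IW: "I \<subseteq> W" using ID g(2) by blast
  define h where "h w = (if w \<in> I then the_inv_into D g w else f w)" for w
  have hI: "h (g c) = c" if "c \<in> D" "g c \<in> I" for c
    using that g(1) by (simp add: h_def the_inv_into_f_f)
  have hA: "h w \<in> A w" if "w \<in> W" for w
  proof (cases "w \<in> I")
    case True
    then obtain c where "c \<in> D" "w = g c" using ID by blast
    then show ?thesis using hI True g by auto
  qed (use that f in \<open>simp add: h_def\<close>)
  have sep: False if "w \<in> I" "w' \<in> W" "w' \<notin> I" "h w = h w'" for w w'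
  proof -
    obtain c where c: "c \<in> D" "w = g c" using ID \<open>w \<in> I\<close> by blast
    then have cf: "c = f w'" using that hI by (simp add: h_def)
    from \<open>w \<in> I\<close> obtain d where d: "d \<in> D" "w = g d" "d \<notin> f ` W \<or> d \<in> f ` I" using I by blast
    have "d = c" using d c g(1) by (simp add: inj_on_eq_iff)
    then have "f w' \<in> f ` I" using d(3) cf \<open>w' \<in> W\<close> by auto
    then show False using f(1) that IW by (metis image_iff inj_on_eq_iff subsetD)
  qed
  have "inj_on h W"
  proof (rule inj_onI)
    fix w w' assume ww: "w \<in> W" "w' \<in> W" "h w = h w'"
    show "w = w'"
    proof (cases "w \<in> I"; cases "w' \<in> I")
      assume "w \<in> I" "w' \<in> I"
      then obtain c c' where "c \<in> D" "w = g c" "c' \<in> D" "w' = g c'" using ID by blast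
      then show ?thesis using hI ww \<open>w \<in> I\<close> \<open>w' \<in> I\<close> by auto
    next
      assume "w \<notin> I" "w' \<notin> I" then show ?thesis using ww f(1) by (simp add: h_def inj_on_eq_iff)
    qed (use sep ww in metis)+
  qed
  moreover have "D \<subseteq> h ` W"
  proof
    fix c assume c: "c \<in> D"
    show "c \<in> h ` W"
    proof (cases "g c \<in> I")
      case True then show ?thesis using hI c IW by (metis image_eqI subsetD)
    next
      case False
      then have "c \<in> f ` W" "c \<notin> f ` I" using I c by blast+
      then show ?thesis by (auto simp: h_def image_iff)
    qed
  qed
  ultimately show ?thesis using hA by blast
qed

text \<open>
  This is a colour class of a \<open>p\<close>-edge-colouring of a bipartite graph of maximum degree \<open>p\<close>
  in which all vertices of \<open>W\<close> have degree \<open>p\<close>.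
\<close>
lemma matching_covering_full_degrees:
  fixes A :: "'i \<Rightarrow> 'c set"
  assumes "finite W" "0 < p" "\<And>w. w \<in> W \<Longrightarrow> card (A w) = p"
    and "\<And>c. card {w \<in> W. c \<in> A w} \<le> p"
  shows "\<exists>h. inj_on h W \<and> (\<forall>w\<in>W. h w \<in> A w) \<and> (\<forall>c. card {w \<in> W. c \<in> A w} = p \<longrightarrow> c \<in> h ` W)"
proof -
  obtain f where f: "inj_on f W" "\<And>w. w \<in> W \<Longrightarrow> f w \<in> A w"
    using regular_sdr[of W p A] assms by blast
  define D where "D = {c. card {w \<in> W. c \<in> A w} = p}"
  have "D \<subseteq> \<Union>(A ` W)"
  proof
    fix c assume "c \<in> D"
    then have "{w \<in> W. c \<in> A w} \<noteq> {}" using assms(2) by (force simp: D_def simp del: Collect_empty_eq)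
    then show "c \<in> \<Union>(A ` W)" by blast
  qed
  moreover have "finite (A w)" if "w \<in> W" for w using assms(2,3) that card_gt_0_iff by metis
  ultimately have finD: "finite D" using assms(1) by (meson finite_UN finite_subset)
  have "\<exists>g. inj_on g D \<and> (\<forall>c\<in>D. g c \<in> {w \<in> W. c \<in> A w})"
  proof (rule regular_sdr[OF finD assms(2)])
    fix w
    show "card {c \<in> D. w \<in> {w \<in> W. c \<in> A w}} \<le> p"
    proof (cases "w \<in> W")
      case True
      have "card {c \<in> D. w \<in> {w \<in> W. c \<in> A w}} \<le> card (A w)"
        using True \<open>\<And>w. w \<in> W \<Longrightarrow> finite (A w)\<close> by (intro card_mono) auto
      then show ?thesis using assms(3) True by simp
    qed simp
  qed (simp add: D_def)
  then obtain g where "inj_on g D" "\<And>c. c \<in> D \<Longrightarrow> g c \<in> W \<and> c \<in> A (g c)" by blast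
  from mendelsohn_dulmage[OF f this] show ?thesis by (auto simp: D_def)
qed

section \<open>Completing an edge colouring on a clique\<close>

text \<open>
  The set \<open>A w\<close> prescribes the colours of the edges from \<open>w\<close> to the uncoloured clique \<open>P\<close>. Every vertex
  of \<open>P\<close> will see all colours, so a colour prescribed at \<open>n\<close> vertices of \<open>W\<close> has to pair up the
  \<open>card P - n\<close> remaining vertices of \<open>P\<close>: this requires the parity and the bound, and no more. The
  vertices of \<open>P\<close> move to \<open>W\<close> one at a time. The edges between \<open>W\<close> and the moving vertex \<open>v\<close>
  must use up every colour prescribed at \<open>card P\<close> vertices, since otherwise that colour
  would be prescribed too often for the smaller clique.
\<close>
lemma amalgamated_clique_colouring:
  fixes A :: "'v \<Rightarrow> 'c set"
  assumes "finite P" "finite W" "W \<inter> P = {}" "finite C" "card C + 1 = card W + card P"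
    and "\<And>w. w \<in> W \<Longrightarrow> A w \<subseteq> C \<and> card (A w) = card P"
    and "\<And>c. c \<in> C \<Longrightarrow> card {w \<in> W. c \<in> A w} \<le> card P \<and> even (card P + card {w \<in> W. c \<in> A w})"
  shows "\<exists>col. (\<forall>v\<in>P. inj_on (\<lambda>z. col {v, z}) (W \<union> P - {v}) \<and> (\<forall>z\<in>W \<union> P - {v}. col {v, z} \<in> C)) \<and>
    (\<forall>w\<in>W. inj_on (\<lambda>v. col {w, v}) P \<and> (\<forall>v\<in>P. col {w, v} \<in> A w))"
  using assms
proof (induction P arbitrary: W A rule: finite_induct)
  case empty then show ?case by simp
next
  case (insert v P)
  note finW = \<open>finite W\<close>
  define n where "n c = card {w \<in> W. c \<in> A w}" for c
  have vW: "v \<notin> W" using insert.prems(2) by blast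
  have cardP: "card (insert v P) = Suc (card P)" using insert.hyps by simp
  have cardA: "card (A w) = Suc (card P)" and AC: "A w \<subseteq> C" if "w \<in> W" for w
    using insert.prems(5) that cardP by auto
  have nle: "n c \<le> Suc (card P)" and nev: "c \<in> C \<Longrightarrow> even (Suc (card P) + n c)" for c
  proof -
    show "n c \<le> Suc (card P)"
    proof (cases "c \<in> C")
      case False
      then have "{w \<in> W. c \<in> A w} = {}" using AC by blast
      then show ?thesis by (simp add: n_def del: Collect_empty_eq)
    qed (use insert.prems(6) cardP in \<open>simp add: n_def\<close>)
    show "c \<in> C \<Longrightarrow> even (Suc (card P) + n c)"
      using insert.prems(6) cardP unfolding n_def by metis
  qed
  obtain h where h: "inj_on h W" "\<forall>w\<in>W. h w \<in> A w" "\<And>c. n c = Suc (card P) \<Longrightarrow> c \<in> h ` W"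
    using matching_covering_full_degrees[OF finW zero_less_Suc cardA, of "\<lambda>w. w"] nle
    unfolding n_def by blast
  define A' where "A' w = (if w = v then C - h ` W else A w - {h w})" for w
  have hC: "h ` W \<subseteq> C" using h AC by blast
  have card_hW: "card (h ` W) = card W" by (rule card_image[OF h(1)])
  have A'W: "A' w = A w - {h w}" if "w \<in> W" for w using that vW by (auto simp: A'_def)
  have "\<exists>col. (\<forall>u\<in>P. inj_on (\<lambda>z. col {u, z}) (insert v W \<union> P - {u}) \<and> (\<forall>z\<in>insert v W \<union> P - {u}. col {u, z} \<in> C)) \<and>
    (\<forall>w\<in>insert v W. inj_on (\<lambda>u. col {w, u}) P \<and> (\<forall>u\<in>P. col {w, u} \<in> A' w))"
  proof (rule insert.IH)
    show "insert v W \<inter> P = {}" using insert.prems insert.hyps by blast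
    show "card C + 1 = card (insert v W) + card P" using insert.prems(4) cardP vW finW by simp
    fix w assume w: "w \<in> insert v W"
    show "A' w \<subseteq> C \<and> card (A' w) = card P"
    proof (cases "w = v")
      case True
      have "card (C - h ` W) = card C - card W"
        using hC card_hW finW by (simp add: card_Diff_subset)
      then show ?thesis using True insert.prems(4) cardP by (simp add: A'_def)
    next
      case False
      then have "w \<in> W" using w by simp
      then show ?thesis using A'W AC[of w] cardA[of w] h(2) by auto
    qed
  next
    fix c assume c: "c \<in> C"
    show "card {w \<in> insert v W. c \<in> A' w} \<le> card P \<and> even (card P + card {w \<in> insert v W. c \<in> A' w})"
    proof (cases "c \<in> h ` W")
      case True
      then obtain w0 where w0: "w0 \<in> W" "c = h w0" by blast
      have "{w \<in> insert v W. c \<in> A' w} = {w \<in> W. c \<in> A w} - {w0}"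
        using True w0 h(1) vW by (auto simp: A'_def inj_on_eq_iff)
      moreover have "w0 \<in> {w \<in> W. c \<in> A w}" using w0 h(2) by blast
      ultimately have "card {w \<in> insert v W. c \<in> A' w} = n c - 1" "0 < n c"
        using finW by (auto simp: n_def card_gt_0_iff)
      then show ?thesis using nle[of c] nev[OF c] by simp
    next
      case False
      have "{w \<in> insert v W. c \<in> A' w} = insert v {w \<in> W. c \<in> A w}"
        using False c vW by (auto simp: A'_def)
      then have "card {w \<in> insert v W. c \<in> A' w} = Suc (n c)"
        using finW vW by (simp add: n_def)
      moreover have "n c \<noteq> Suc (card P)" using h(3) False by blast
      moreover from this have "n c \<noteq> card P" using nev[OF c] by auto
      ultimately show ?thesis using nle[of c] nev[OF c] by simp
    qed
  qed (use finW insert.prems in auto)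
  then obtain col where col:
    "\<And>u. u \<in> P \<Longrightarrow> inj_on (\<lambda>z. col {u, z}) (insert v W \<union> P - {u})"
    "\<And>u z. u \<in> P \<Longrightarrow> z \<in> insert v W \<union> P - {u} \<Longrightarrow> col {u, z} \<in> C"
    "\<And>w. w \<in> insert v W \<Longrightarrow> inj_on (\<lambda>u. col {w, u}) P"
    "\<And>w u. w \<in> insert v W \<Longrightarrow> u \<in> P \<Longrightarrow> col {w, u} \<in> A' w" by metis
  define k where "k e = (if \<exists>w\<in>W. e = {w, v} then h (THE w. w \<in> W \<and> e = {w, v}) else col e)" for e
  have kW: "k {w, v} = h w" "k {v, w} = h w" if "w \<in> W" for w
  proof -
    have "(THE w'. w' \<in> W \<and> {w, v} = {w', v}) = w"
      using that by (intro the_equality) (auto simp: doubleton_eq_iff)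
    then show "k {w, v} = h w" using that by (auto simp: k_def)
    then show "k {v, w} = h w" by (simp add: insert_commute)
  qed
  have kP: "k {u, z} = col {u, z}" "k {z, u} = col {u, z}" if "u \<in> P" for u z
  proof -
    have "\<not> (\<exists>w\<in>W. {u, z} = {w, v})"
      using that insert.prems(2) insert.hyps by (auto simp: doubleton_eq_iff)
    then show "k {u, z} = col {u, z}" by (simp add: k_def)
    then show "k {z, u} = col {u, z}" by (simp add: insert_commute)
  qed
  have A'v: "A' v = C - h ` W" by (simp add: A'_def)
  have "inj_on (\<lambda>z. k {u, z}) (W \<union> insert v P - {u}) \<and> (\<forall>z\<in>W \<union> insert v P - {u}. k {u, z} \<in> C)"
    if u: "u \<in> insert v P" for u
  proof (cases "u = v")
    case True
    have eq: "W \<union> insert v P - {u} = W \<union> P" using True vW insert.hyps by blast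
    have kPv: "k {v, z} = col {v, z}" "col {v, z} \<in> C - h ` W" if "z \<in> P" for z
      using kP[OF that] col(4)[of v z] that A'v by (auto simp: insert_commute)
    have "inj_on (\<lambda>z. k {v, z}) W" using kW h(1) by (simp add: inj_on_def)
    moreover have "inj_on (\<lambda>z. k {v, z}) P" using kPv col(3)[of v] by (simp add: inj_on_def)
    moreover have "(\<lambda>z. k {v, z}) ` (W - P) \<inter> (\<lambda>z. k {v, z}) ` (P - W) = {}"
    proof -
      have "k {v, y} \<noteq> k {v, z}" if "y \<in> W" "z \<in> P" for y z
      proof -
        have "h y \<in> h ` W" using that(1) by (rule imageI)
        moreover have "col {v, z} \<notin> h ` W" using kPv(2)[OF that(2)] by simp
        ultimately have "h y \<noteq> col {v, z}" by metis
        then show ?thesis unfolding kPv(1)[OF that(2)] kW(2)[OF that(1)] .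
      qed
      then show ?thesis by blast
    qed
    ultimately have "inj_on (\<lambda>z. k {v, z}) (W \<union> P)" by (simp add: inj_on_Un)
    moreover have "k {v, z} \<in> C" if "z \<in> W \<union> P" for z
    proof (cases "z \<in> W")
      case True then show ?thesis using kW(2)[OF True] hC by auto
    next
      case False
      then have "z \<in> P" using that by blast
      then show ?thesis using kPv[of z] by auto
    qed
    ultimately show ?thesis using True eq by simp
  next
    case False
    then have uP: "u \<in> P" using u by simp
    have eq: "W \<union> insert v P - {u} = insert v W \<union> P - {u}" by blast
    show ?thesis unfolding eq kP(1)[OF uP] using col(1,2)[OF uP] by blast
  qed
  moreover have "inj_on (\<lambda>u. k {w, u}) (insert v P) \<and> (\<forall>u\<in>insert v P. k {w, u} \<in> A w)"
    if w: "w \<in> W" for w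
  proof -
    have kPw: "k {w, u} = col {w, u}" "col {w, u} \<in> A w - {h w}" if "u \<in> P" for u
      using kP[OF that, of w] col(4)[of w u] that A'W[OF w] w by (auto simp: insert_commute)
    have "inj_on (\<lambda>u. k {w, u}) P" using col(3)[of w] w kPw by (simp add: inj_on_def)
    moreover have "k {w, v} \<noteq> k {w, u}" if "u \<in> P" for u
      using kPw[OF that] kW(1)[OF w] by auto
    ultimately have "inj_on (\<lambda>u. k {w, u}) (insert v P)" unfolding inj_on_insert by blast
    moreover have "k {w, u} \<in> A w" if "u \<in> insert v P" for u
    proof (cases "u = v")
      case True then show ?thesis using kW(1)[OF w] h(2) w by auto
    next
      case False
      then have "u \<in> P" using that by blast
      then show ?thesis using kPw[of u] by auto
    qed
    ultimately show ?thesis by blast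
  qed
  ultimately show ?case by blast
qed

section \<open>Complete graphs of odd order with few edges deleted\<close>

definition proper_on :: "'a set set \<Rightarrow> ('a set \<Rightarrow> 'c) \<Rightarrow> bool" where
  "proper_on E c \<longleftrightarrow> (\<forall>e\<in>E. \<forall>f\<in>E. e \<noteq> f \<and> e \<inter> f \<noteq> {} \<longrightarrow> c e \<noteq> c f)"

lemma pair_at:
  assumes "e \<in> [V]\<^bsup>2\<^esup>" "v \<in> e"
  obtains y where "e = {v, y}" "y \<noteq> v" "y \<in> V" "v \<in> V"
  using assms by (auto simp: nsets_2_eq)

lemma proper_on_pairsI:
  assumes "E \<subseteq> [V]\<^bsup>2\<^esup>"
    and "\<And>v y z. {v, y} \<in> E \<Longrightarrow> {v, z} \<in> E \<Longrightarrow> y \<noteq> z \<Longrightarrow> c {v, y} \<noteq> c {v, z}"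
  shows "proper_on E c"
  unfolding proper_on_def
proof (intro ballI impI)
  fix e f assume ef: "e \<in> E" "f \<in> E" "e \<noteq> f \<and> e \<inter> f \<noteq> {}"
  then obtain v where v: "v \<in> e" "v \<in> f" by blast
  obtain y z where "e = {v, y}" "f = {v, z}"
    using v ef assms(1) pair_at by (metis subsetD)
  then show "c e \<noteq> c f" using ef assms(2) by blast
qed

lemma greedy_extension:
  fixes c0 :: "'a set \<Rightarrow> 'c"
  assumes "finite F" "finite E0" "E0 \<inter> F = {}" "proper_on E0 c0" "finite C"
    and "\<And>e. e \<in> F \<Longrightarrow> finite (forb e) \<and> card (forb e) + card {f \<in> E0 \<union> F. f \<noteq> e \<and> f \<inter> e \<noteq> {}} < card C"
  shows "\<exists>c. (\<forall>e\<in>E0. c e = c0 e) \<and> proper_on (E0 \<union> F) c \<and> (\<forall>e\<in>F. c e \<in> C - forb e)"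
  using assms
proof (induction F rule: finite_induct)
  case empty then show ?case by auto
next
  case (insert e F)
  have "\<exists>c. (\<forall>e\<in>E0. c e = c0 e) \<and> proper_on (E0 \<union> F) c \<and> (\<forall>e\<in>F. c e \<in> C - forb e)"
  proof (rule insert.IH)
    fix f assume f: "f \<in> F"
    have "card {g \<in> E0 \<union> F. g \<noteq> f \<and> g \<inter> f \<noteq> {}} \<le> card {g \<in> E0 \<union> insert e F. g \<noteq> f \<and> g \<inter> f \<noteq> {}}"
      using insert.prems(1) insert.hyps(1) by (intro card_mono) auto
    then show "finite (forb f) \<and> card (forb f) + card {g \<in> E0 \<union> F. g \<noteq> f \<and> g \<inter> f \<noteq> {}} < card C"
      using insert.prems(5)[of f] f by auto
  qed (use insert.prems in auto)
  then obtain c where c: "\<forall>e\<in>E0. c e = c0 e" "proper_on (E0 \<union> F) c" "\<forall>e\<in>F. c e \<in> C - forb e" by blast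
  let ?N = "{f \<in> E0 \<union> F. f \<inter> e \<noteq> {}}"
  have "{f \<in> E0 \<union> insert e F. f \<noteq> e \<and> f \<inter> e \<noteq> {}} = ?N"
    using insert.prems(2) insert.hyps(2) by auto
  then have lt: "finite (forb e)" "card (forb e) + card ?N < card C"
    using insert.prems(5)[of e] by auto
  have "card (forb e \<union> c ` ?N) \<le> card (forb e) + card ?N"
    using insert.prems(1) insert.hyps(1) by (intro order.trans[OF card_Un_le] add_left_mono card_image_le) auto
  then have "\<not> C \<subseteq> forb e \<union> c ` ?N"
    using lt insert.prems(1) insert.hyps(1) card_mono[of "forb e \<union> c ` ?N" C] by auto
  then obtain x where x: "x \<in> C" "x \<notin> forb e" "x \<notin> c ` ?N" by blast
  have eE0: "e \<notin> E0" "e \<notin> F" using insert.prems(2) insert.hyps(2) by auto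
  have "proper_on (E0 \<union> insert e F) (c(e := x))"
    using c(2) x(3) eE0 unfolding proper_on_def by (auto simp: Int_commute)
  moreover have "\<forall>f\<in>E0. (c(e := x)) f = c0 f" using c(1) eE0 by auto
  moreover have "\<forall>f\<in>insert e F. (c(e := x)) f \<in> C - forb f" using c(3) x eE0 by auto
  ultimately show ?case by blast
qed

lemma card_pairs_at:
  assumes "finite W" "w \<in> W"
  shows "card {e \<in> [W]\<^bsup>2\<^esup>. w \<in> e} = card W - 1"
proof -
  have "{e \<in> [W]\<^bsup>2\<^esup>. w \<in> e} = (\<lambda>z. {w, z}) ` (W - {w})"
    using assms by (auto simp: nsets_2_eq)
  moreover have "inj_on (\<lambda>z. {w, z}) (W - {w})" by (auto simp: inj_on_def doubleton_eq_iff)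
  ultimately show ?thesis using assms by (simp add: card_image)
qed

lemma card_adjacent_pairs:
  assumes "finite E" "{a, b} \<in> E" "a \<noteq> b"
  shows "card {f \<in> E. f \<noteq> {a, b} \<and> f \<inter> {a, b} \<noteq> {}} + 2 \<le> card {f \<in> E. a \<in> f} + card {f \<in> E. b \<in> f}"
proof -
  have "{f \<in> E. f \<noteq> {a, b} \<and> f \<inter> {a, b} \<noteq> {}} \<subseteq> ({f \<in> E. a \<in> f} - {{a, b}}) \<union> ({f \<in> E. b \<in> f} - {{a, b}})"
    by auto
  then have "card {f \<in> E. f \<noteq> {a, b} \<and> f \<inter> {a, b} \<noteq> {}} \<le>
      card ({f \<in> E. a \<in> f} - {{a, b}}) + card ({f \<in> E. b \<in> f} - {{a, b}})"
    using assms(1) by (intro order.trans[OF card_mono card_Un_le]) auto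
  moreover have "card ({f \<in> E. a \<in> f} - {{a, b}}) + 1 = card {f \<in> E. a \<in> f}"
    "card ({f \<in> E. b \<in> f} - {{a, b}}) + 1 = card {f \<in> E. b \<in> f}"
    using assms card_Suc_Diff1[of "{f \<in> E. a \<in> f}" "{a, b}"] card_Suc_Diff1[of "{f \<in> E. b \<in> f}" "{a, b}"] by auto
  ultimately show ?thesis by linarith
qed

text \<open>
  The map \<open>\<nu>\<close> hands out all \<open>2 * m\<close> colours as missing colours, one to each end of each deleted pair. At a
  vertex of \<open>W\<close> the missing colours and the pairs of \<open>W\<close> kept there together number \<open>card W - 1\<close>, so at most
  \<open>2 * (card W - 2)\<close> colours are ever forbidden and the greedy colouring does not get stuck. The colours left over at \<open>w\<close> are
  exactly as many as there are edges from \<open>w\<close> to the vertices outside \<open>W\<close>. The partial colouring \<open>c0\<close> leaves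
  room for further requirements on some of the pairs.
\<close>
lemma tight_colouring:
  fixes V W :: "'a set" and \<nu> :: "'a \<times> 'a set \<Rightarrow> nat"
  assumes "finite V" "card V = 2 * m + 1" "W \<subseteq> V" "B \<subseteq> [W]\<^bsup>2\<^esup>" "card W \<le> m + 1"
    and \<nu>: "bij_betw \<nu> {(w, e). e \<in> B \<and> w \<in> e} {..<2 * m}"
    and E0: "E0 \<subseteq> [W]\<^bsup>2\<^esup> - B" "proper_on E0 c0"
      "\<And>e. e \<in> E0 \<Longrightarrow> c0 e < 2 * m \<and> (\<forall>w\<in>e. \<forall>b\<in>B. w \<in> b \<longrightarrow> c0 e \<noteq> \<nu> (w, b))"
  shows "\<exists>col. (\<forall>e\<in>E0. col e = c0 e) \<and> proper_on ([V]\<^bsup>2\<^esup> - B) col \<and>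
    (\<forall>e\<in>[V]\<^bsup>2\<^esup> - B. col e < 2 * m \<and> (\<forall>w\<in>e. \<forall>b\<in>B. w \<in> b \<longrightarrow> col e \<noteq> \<nu> (w, b)))"
proof -
  have finW: "finite W" using assms finite_subset by blast
  have finK: "finite ([W]\<^bsup>2\<^esup>)" by (rule finite_imp_finite_nsets[OF finW])
  have finB: "finite B" using assms(4) finK finite_subset by blast
  define miss where "miss w = (\<lambda>b. \<nu> (w, b)) ` {b \<in> B. w \<in> b}" for w
  define G where "G = [W]\<^bsup>2\<^esup> - B"
  have finG: "finite G" using finK by (simp add: G_def)
  have missC: "miss w \<subseteq> {..<2 * m}" for w using \<nu> by (auto simp: miss_def bij_betw_def)
  have finmiss: "finite (miss w)" for w by (meson missC finite_lessThan finite_subset)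
  have card_miss: "card (miss w) = card {b \<in> B. w \<in> b}" for w
    unfolding miss_def using \<nu> by (intro card_image) (auto simp: bij_betw_def inj_on_def)
  have degs: "card {e \<in> G. w \<in> e} + card (miss w) = card W - 1" if "w \<in> W" for w
  proof -
    have "{e \<in> [W]\<^bsup>2\<^esup>. w \<in> e} = {e \<in> G. w \<in> e} \<union> {b \<in> B. w \<in> b}"
      using assms(4) by (auto simp: G_def)
    moreover have "{e \<in> G. w \<in> e} \<inter> {b \<in> B. w \<in> b} = {}" by (auto simp: G_def)
    ultimately have "card {e \<in> [W]\<^bsup>2\<^esup>. w \<in> e} = card {e \<in> G. w \<in> e} + card {b \<in> B. w \<in> b}"
      using finB finG by (simp add: card_Un_disjoint)
    then show ?thesis using card_pairs_at[OF finW that] card_miss by simp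
  qed
  have "\<exists>c. (\<forall>e\<in>E0. c e = c0 e) \<and> proper_on (E0 \<union> (G - E0)) c \<and> (\<forall>e\<in>G - E0. c e \<in> {..<2 * m} - \<Union>(miss ` e))"
  proof (rule greedy_extension)
    fix e assume e: "e \<in> G - E0"
    then obtain a b where ab: "e = {a, b}" "a \<in> W" "b \<in> W" "a \<noteq> b" by (auto simp: G_def nsets_2_eq)
    have EG: "E0 \<union> (G - E0) = G" using E0(1) by (auto simp: G_def)
    have "card {f \<in> G. f \<noteq> e \<and> f \<inter> e \<noteq> {}} + 2 \<le> card {f \<in> G. a \<in> f} + card {f \<in> G. b \<in> f}"
      unfolding ab(1) using e ab by (intro card_adjacent_pairs[OF finG]) auto
    moreover have "card (\<Union>(miss ` e)) \<le> card (miss a) + card (miss b)"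
      unfolding ab(1) by (simp add: card_Un_le)
    moreover have "card W \<ge> 2" using ab finW card_mono[of W "{a, b}"] by simp
    ultimately have "card (\<Union>(miss ` e)) + card {f \<in> G. f \<noteq> e \<and> f \<inter> e \<noteq> {}} < 2 * m"
      using degs[OF ab(2)] degs[OF ab(3)] assms(5) by linarith
    then show "finite (\<Union>(miss ` e)) \<and>
        card (\<Union>(miss ` e)) + card {f \<in> E0 \<union> (G - E0). f \<noteq> e \<and> f \<inter> e \<noteq> {}} < card {..<2 * m}"
      using finmiss ab EG by simp
  qed (use E0 finG finite_subset G_def in auto)
  then obtain c where c: "\<forall>e\<in>E0. c e = c0 e" "proper_on G c" "\<forall>e\<in>G - E0. c e \<in> {..<2 * m} - \<Union>(miss ` e)"
    using E0(1) by (metis G_def Un_Diff_cancel sup.absorb2)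
  have cG: "c e < 2 * m" "\<And>w. w \<in> e \<Longrightarrow> c e \<notin> miss w" if "e \<in> G" for e
    using that c(1,3) E0(3)[of e] by (cases "e \<in> E0"; auto simp: miss_def)+
  define P where "P = V - W"
  define A where "A w = {..<2 * m} - miss w - c ` {e \<in> G. w \<in> e}" for w
  have cardP: "card P + card W = 2 * m + 1"
    unfolding P_def using assms finW card_mono[of V W] by (simp add: card_Diff_subset)
  have inj_at: "inj_on c {e \<in> G. w \<in> e}" for w
    using c(2) unfolding proper_on_def inj_on_def by blast
  have cardA: "card (A w) = card P" if w: "w \<in> W" for w
  proof -
    have "miss w \<inter> c ` {e \<in> G. w \<in> e} = {}" using cG(2) by blast
    moreover have sub: "miss w \<union> c ` {e \<in> G. w \<in> e} \<subseteq> {..<2 * m}" using missC cG(1) by auto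
    moreover have "A w = {..<2 * m} - (miss w \<union> c ` {e \<in> G. w \<in> e})" unfolding A_def by blast
    ultimately have "card (A w) = 2 * m - (card (miss w) + card {e \<in> G. w \<in> e})"
      using finmiss finG inj_at[of w] by (simp add: card_Diff_subset card_Un_disjoint card_image)
    moreover have "card W > 0" using w finW card_gt_0_iff by blast
    ultimately show ?thesis using degs[OF w] cardP by linarith
  qed
  \<comment> \<open>A colour is absent from \<open>A w\<close> at its unique missing vertex and at the ends of its edges in \<open>W\<close>: an odd number of vertices.\<close>
  have parity: "card {w \<in> W. x \<in> A w} \<le> card P \<and> even (card P + card {w \<in> W. x \<in> A w})"
    if x: "x \<in> {..<2 * m}" for x
  proof -
    obtain w0 b0 where w0: "b0 \<in> B" "w0 \<in> b0" "\<nu> (w0, b0) = x" 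
    proof -
      have "x \<in> \<nu> ` {(w, e). e \<in> B \<and> w \<in> e}" using x \<nu> by (simp add: bij_betw_def)
      then show thesis using that by auto
    qed
    have w0W: "w0 \<in> W" using w0 assms(4) by (auto simp: nsets_def)
    have missx: "x \<in> miss w \<longleftrightarrow> w = w0" for w
    proof
      assume "x \<in> miss w"
      then obtain b where "b \<in> B" "w \<in> b" "\<nu> (w, b) = \<nu> (w0, b0)" using w0 by (auto simp: miss_def)
      then show "w = w0" using \<nu> w0 by (auto simp: bij_betw_def dest!: inj_onD)
    qed (use w0 in \<open>auto simp: miss_def\<close>)
    define M where "M = {e \<in> G. c e = x}"
    have "card (\<Union>M) = (\<Sum>e\<in>M. card e)"
    proof (rule card_Union_disjoint)
      show "pairwise disjnt M" using c(2) unfolding pairwise_def disjnt_def M_def proper_on_def by auto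
      show "\<And>e. e \<in> M \<Longrightarrow> finite e" by (auto simp: M_def G_def nsets_def)
    qed
    also have "\<dots> = 2 * card M" by (simp add: M_def G_def nsets_def)
    finally have cardM: "card (\<Union>M) = 2 * card M" .
    have MW: "\<Union>M \<subseteq> W" by (auto simp: M_def G_def nsets_def)
    have w0M: "w0 \<notin> \<Union>M" using cG(2) missx by (auto simp: M_def)
    have "{w \<in> W. x \<in> A w} = W - insert w0 (\<Union>M)"
      using x missx by (auto simp: A_def M_def)
    moreover have "card (insert w0 (\<Union>M)) = 2 * card M + 1"
      using w0M MW finW cardM finite_subset by (metis Suc_eq_plus1 card_insert_disjoint)
    ultimately have eq: "card {w \<in> W. x \<in> A w} = card W - (2 * card M + 1)"
      using MW w0W finW by (metis card_Diff_subset finite_subset insert_subset)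
    have "2 * card M + 1 \<le> card W"
      using \<open>card (insert w0 (\<Union>M)) = _\<close> MW w0W finW by (metis card_mono insert_subset)
    then show ?thesis using eq cardP assms(5) by auto
  qed
  obtain cP where cP:
    "\<And>v. v \<in> P \<Longrightarrow> inj_on (\<lambda>z. cP {v, z}) (W \<union> P - {v})"
    "\<And>v z. v \<in> P \<Longrightarrow> z \<in> W \<union> P - {v} \<Longrightarrow> cP {v, z} \<in> {..<2 * m}"
    "\<And>w. w \<in> W \<Longrightarrow> inj_on (\<lambda>v. cP {w, v}) P"
    "\<And>w v. w \<in> W \<Longrightarrow> v \<in> P \<Longrightarrow> cP {w, v} \<in> A w"
  proof -
    have "\<exists>col. (\<forall>v\<in>P. inj_on (\<lambda>z. col {v, z}) (W \<union> P - {v}) \<and> (\<forall>z\<in>W \<union> P - {v}. col {v, z} \<in> {..<2 * m})) \<and>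
      (\<forall>w\<in>W. inj_on (\<lambda>v. col {w, v}) P \<and> (\<forall>v\<in>P. col {w, v} \<in> A w))"
      by (rule amalgamated_clique_colouring)
        (use assms(1) finW cardP cardA parity in \<open>auto simp: P_def A_def\<close>)
    then show thesis using that by metis
  qed
  define col where "col e = (if e \<subseteq> W then c e else cP e)" for e
  have Veq: "V = W \<union> P" using assms(3) by (auto simp: P_def)
  have WP: "W \<inter> P = {}" by (auto simp: P_def)
  have inG: "{v, z} \<in> G" if "{v, z} \<in> [V]\<^bsup>2\<^esup> - B" "v \<in> W" "z \<in> W" for v z
    using that by (auto simp: G_def)
  have "col {v, y} \<noteq> col {v, z}"
    if yz: "{v, y} \<in> [V]\<^bsup>2\<^esup> - B" "{v, z} \<in> [V]\<^bsup>2\<^esup> - B" "y \<noteq> z" for v y z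
  proof (cases "v \<in> P")
    case True
    then have "y \<in> W \<union> P - {v}" "z \<in> W \<union> P - {v}" using yz Veq by auto
    then have "cP {v, y} \<noteq> cP {v, z}" using cP(1)[OF True] yz(3) by (meson inj_onD)
    then show ?thesis using True WP by (auto simp: col_def)
  next
    case False
    then have v: "v \<in> W" using yz(1) Veq by auto
    have mixed: "c {v, y'} \<noteq> cP {v, z'}" if "{v, y'} \<in> [V]\<^bsup>2\<^esup> - B" "y' \<in> W" "z' \<in> P" for y' z'
    proof -
      have "c {v, y'} \<in> c ` {e \<in> G. v \<in> e}" using inG[OF that(1) v that(2)] by auto
      moreover have "cP {v, z'} \<notin> c ` {e \<in> G. v \<in> e}" using cP(4)[OF v that(3)] by (simp add: A_def)
      ultimately show ?thesis by metis
    qed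
    consider "y \<in> W" "z \<in> W" | "y \<in> W" "z \<in> P" | "y \<in> P" "z \<in> W" | "y \<in> P" "z \<in> P"
      using yz Veq by auto
    then show ?thesis
    proof cases
      case 1
      have "{v, y} \<noteq> {v, z}" using yz(3) by (auto simp: doubleton_eq_iff)
      then show ?thesis using 1 v inG yz c(2) by (auto simp: col_def proper_on_def)
    next
      case 2 then show ?thesis using mixed[OF yz(1)] v WP by (auto simp: col_def)
    next
      case 3 then show ?thesis using mixed[OF yz(2), of y] v WP by (auto simp: col_def)
    next
      case 4
      then have "cP {v, y} \<noteq> cP {v, z}" using cP(3)[OF v] yz(3) by (meson inj_onD)
      then show ?thesis using 4 WP by (auto simp: col_def)
    qed
  qed
  then have "proper_on ([V]\<^bsup>2\<^esup> - B) col"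
    by (intro proper_on_pairsI[of _ V]) auto
  moreover have "col e < 2 * m \<and> (\<forall>w\<in>e. \<forall>b\<in>B. w \<in> b \<longrightarrow> col e \<noteq> \<nu> (w, b))"
    if e: "e \<in> [V]\<^bsup>2\<^esup> - B" for e
  proof (cases "e \<subseteq> W")
    case True
    then have "e \<in> G" using e by (auto simp: G_def nsets_def)
    then show ?thesis using cG[of e] True by (auto simp: col_def miss_def)
  next
    case False
    then obtain v z where vz: "e = {v, z}" "v \<in> P" "z \<in> W \<union> P - {v}"
      using e Veq by (auto simp: nsets_2_eq)
    have "cP e \<noteq> \<nu> (w, b)" if "w \<in> e" "b \<in> B" "w \<in> b" for w b
    proof -
      have "w \<in> W" using that assms(4) by (auto simp: nsets_def)
      then have "cP {w, v} \<in> A w" "w = z" using cP(4)[OF _ vz(2)] that vz WP by auto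
      then show ?thesis using that vz by (auto simp: A_def miss_def insert_commute)
    qed
    moreover have "col e = cP e" using False by (simp add: col_def)
    moreover have "cP e < 2 * m" using cP(2)[OF vz(2,3)] vz(1) by simp
    ultimately show ?thesis by simp
  qed
  moreover have "\<forall>e\<in>E0. col e = c0 e"
    using c(1) E0(1) by (auto simp: col_def nsets_def)
  ultimately show ?thesis by blast
qed

section \<open>Joins of a clique and a stable set\<close>

text \<open>
  The stable vertices \<open>S\<close> are completely joined to the clique \<open>Q\<close>, and a deleted pair \<open>{s, a}\<close> with \<open>a \<in> Q\<close> is
  coloured as well, by the colour missing at \<open>a\<close> on its account. All clashes then
  occur at stable vertices, between a deleted and a kept pair, because
  missing colours of different vertices differ. For one stable vertex \<open>i\<close> they can also be avoided on
  a set \<open>N\<close>, by colouring the kept pairs between \<open>i\<close> and \<open>N\<close> first.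
\<close>
lemma split_join_colouring:
  fixes Q S W N :: "'a set" and B :: "'a set set" and m :: nat and i :: 'a
  assumes fin: "finite Q" "finite S" and QS: "Q \<inter> S = {}" "card Q + card S = 2 * m + 1"
    and W: "W \<subseteq> Q \<union> S" "card W \<le> m + 1" "B \<subseteq> [W]\<^bsup>2\<^esup>" "card B = m"
    and BQ: "\<And>a b. a \<in> Q \<Longrightarrow> b \<in> Q \<Longrightarrow> {a, b} \<notin> B"
    and N: "N \<subseteq> W \<inter> Q" "N \<noteq> {} \<Longrightarrow> i \<in> S \<inter> W"
      "N \<noteq> {} \<Longrightarrow> 2 * card S + card {a \<in> Q. {i, a} \<in> B} + card (W \<inter> Q) < 2 * m + 3"
  shows "\<exists>c. (\<forall>u\<in>Q. \<forall>z\<in>Q \<union> S - {u}. c {u, z} < 2 * m) \<and>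
    (\<forall>u\<in>Q. inj_on (\<lambda>z. c {u, z}) (Q \<union> S - {u})) \<and>
    (\<forall>s\<in>S. \<forall>a\<in>Q. \<forall>b\<in>Q. a \<noteq> b \<and> c {s, a} = c {s, b} \<longrightarrow> ({s, a} \<in> B \<longleftrightarrow> {s, b} \<notin> B)) \<and>
    (\<forall>a\<in>Q. \<forall>b\<in>N. {i, a} \<in> B \<and> {i, b} \<notin> B \<longrightarrow> c {i, a} \<noteq> c {i, b})"
proof -
  let ?V = "Q \<union> S"
  let ?H = "{(w, e). e \<in> B \<and> w \<in> e}"
  have finV: "finite ?V" and finW: "finite W" using fin W(1) finite_subset by auto
  have cardV: "card ?V = 2 * m + 1" using fin QS by (simp add: card_Un_disjoint)
  have finK: "finite ([W]\<^bsup>2\<^esup>)" by (rule finite_imp_finite_nsets[OF finW])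
  then have finB: "finite B" using W(3) finite_subset by blast
  have Bpair: "finite e" "card e = 2" if "e \<in> B" for e using that W(3) by (auto simp: nsets_def)
  have H: "?H = prod.swap ` Sigma B (\<lambda>e. e)" by (auto simp: image_iff)
  have "card ?H = (\<Sum>e\<in>B. card e)"
    unfolding H using finB Bpair by (subst card_image) (auto simp: card_SigmaI)
  then have "card ?H = 2 * m" using Bpair(2) W(4) by simp
  moreover have "finite ?H" unfolding H using finB Bpair(1) by auto
  ultimately obtain \<nu> where \<nu>: "bij_betw \<nu> ?H {..<2 * m}"
    by (metis card_lessThan finite_lessThan finite_same_card_bij)
  have \<nu>inj: "w = w' \<and> e = e'" if "\<nu> (w, e) = \<nu> (w', e')" "e \<in> B" "w \<in> e" "e' \<in> B" "w' \<in> e'" for w e w' e'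
    using \<nu> that unfolding bij_betw_def inj_on_def by fast
  have \<nu>lt: "\<nu> (w, e) < 2 * m" if "e \<in> B" "w \<in> e" for w e
    using \<nu> that unfolding bij_betw_def by auto
  define E0 where "E0 = (\<lambda>b. {i, b}) ` {b \<in> N. {i, b} \<notin> B}"
  define miss where "miss w = (\<lambda>b. \<nu> (w, b)) ` {b \<in> B. w \<in> b}" for w
  define Y where "Y = {a \<in> Q. {i, a} \<in> B}"
  have card_miss: "card (miss w) \<le> card {b \<in> B. w \<in> b}" "finite (miss w)" for w
    using finB by (auto simp: miss_def intro: card_image_le)
  have finN: "finite N" using N(1) finW finite_subset by blast
  have finY: "finite Y" using fin by (simp add: Y_def)
  have BW: "w \<in> W \<and> z \<in> W \<and> w \<noteq> z" if "{w, z} \<in> B" for w z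
    using subsetD[OF W(3) that] by simp
  have E0: "E0 \<subseteq> [W]\<^bsup>2\<^esup> - B"
  proof
    fix e assume "e \<in> E0"
    then obtain b where b: "b \<in> N" "{i, b} \<notin> B" "e = {i, b}" by (auto simp: E0_def)
    moreover have "i \<in> S" "i \<in> W" "b \<in> W" "b \<in> Q" using b N(1,2) by auto
    moreover have "i \<noteq> b" using QS(1) \<open>i \<in> S\<close> \<open>b \<in> Q\<close> by blast
    ultimately show "e \<in> [W]\<^bsup>2\<^esup> - B" by simp
  qed
  have "\<exists>c. (\<forall>e\<in>{}. c e = undefined e) \<and> proper_on ({} \<union> E0) c \<and>
      (\<forall>e\<in>E0. c e \<in> {..<2 * m} - (\<Union>(miss ` e) \<union> (\<lambda>a. \<nu> (a, {i, a})) ` Y))"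
  proof (rule greedy_extension)
    show "finite E0" using finN by (simp add: E0_def)
    fix e assume e: "e \<in> E0"
    then obtain b where b: "e = {i, b}" "b \<in> N" "{i, b} \<notin> B" by (auto simp: E0_def)
    have iS: "i \<in> S" "i \<in> W" and NE: "N \<noteq> {}" using N(2) b by auto
    have bQ: "b \<in> Q" "b \<in> W" using b N(1) by auto
    have ib: "i \<noteq> b" using iS bQ QS by blast
    have at: "{f \<in> B. w \<in> f} \<subseteq> (\<lambda>z. {w, z}) ` {z. {w, z} \<in> B}" for w
      using W(3) by (auto elim!: pair_at)
    have degb: "card {f \<in> B. b \<in> f} \<le> card S - 1"
    proof -
      have "{z. {b, z} \<in> B} \<subseteq> S - {i}"
      proof
        fix z assume "z \<in> {z. {b, z} \<in> B}"
        then have z: "{b, z} \<in> B" by simp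
        then have "z \<in> Q \<union> S" "z \<notin> Q" using BW[OF z] W(1) BQ[OF bQ(1)] by blast+
        moreover have "z \<noteq> i" using z b(3) by (auto simp: insert_commute)
        ultimately show "z \<in> S - {i}" by blast
      qed
      then have "{f \<in> B. b \<in> f} \<subseteq> (\<lambda>z. {b, z}) ` (S - {i})"
        using at[of b] by (meson image_mono subset_trans)
      then have "card {f \<in> B. b \<in> f} \<le> card ((\<lambda>z. {b, z}) ` (S - {i}))"
        using fin by (intro card_mono) auto
      also have "\<dots> \<le> card (S - {i})" using fin by (intro card_image_le) auto
      finally show ?thesis using iS fin by simp
    qed
    have degi: "card {f \<in> B. i \<in> f} \<le> card S - 1 + card Y"
    proof -
      have "{z. {i, z} \<in> B} \<subseteq> (S - {i}) \<union> Y"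
      proof
        fix z assume "z \<in> {z. {i, z} \<in> B}"
        then have z: "{i, z} \<in> B" by simp
        then show "z \<in> (S - {i}) \<union> Y" using BW[OF z] W(1) by (auto simp: Y_def)
      qed
      then have "{f \<in> B. i \<in> f} \<subseteq> (\<lambda>z. {i, z}) ` ((S - {i}) \<union> Y)"
        using at[of i] by (meson image_mono subset_trans)
      then have "card {f \<in> B. i \<in> f} \<le> card ((\<lambda>z. {i, z}) ` ((S - {i}) \<union> Y))"
        using fin finY by (intro card_mono) auto
      also have "\<dots> \<le> card ((S - {i}) \<union> Y)" using fin finY by (intro card_image_le) auto
      also have "\<dots> \<le> card (S - {i}) + card Y" by (rule card_Un_le)
      finally show ?thesis using iS fin by simp
    qed
    have sizeY: "card Y + card {b \<in> N. {i, b} \<notin> B} \<le> card (W \<inter> Q)"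
    proof -
      have "Y \<union> {b \<in> N. {i, b} \<notin> B} \<subseteq> W \<inter> Q" using N(1) BW by (auto simp: Y_def)
      moreover have "Y \<inter> {b \<in> N. {i, b} \<notin> B} = {}" by (auto simp: Y_def)
      moreover have "finite {b \<in> N. {i, b} \<notin> B}" "finite (W \<inter> Q)" using finN finW by auto
      ultimately show ?thesis
        using card_Un_disjoint[OF finY] card_mono[of "W \<inter> Q" "Y \<union> {b \<in> N. {i, b} \<notin> B}"] by simp
    qed
    have "card {f \<in> E0. f \<noteq> e \<and> f \<inter> e \<noteq> {}} \<le> card (E0 - {e})"
      using \<open>finite E0\<close> by (intro card_mono) auto
    moreover have "card E0 \<le> card {b \<in> N. {i, b} \<notin> B}" unfolding E0_def using finN by (intro card_image_le) auto
    moreover have "card E0 > 0" using e \<open>finite E0\<close> card_gt_0_iff by blast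
    ultimately have adj: "card {f \<in> E0. f \<noteq> e \<and> f \<inter> e \<noteq> {}} + 1 \<le> card {b \<in> N. {i, b} \<notin> B}"
      using e \<open>finite E0\<close> by simp
    have "card (\<Union>(miss ` e) \<union> (\<lambda>a. \<nu> (a, {i, a})) ` Y) \<le> card (miss i \<union> miss b) + card ((\<lambda>a. \<nu> (a, {i, a})) ` Y)"
      unfolding b(1) by (simp add: card_Un_le)
    also have "\<dots> \<le> (card (miss i) + card (miss b)) + card Y"
      using finY by (intro add_mono card_Un_le card_image_le)
    also have "\<dots> \<le> (card S - 1 + card Y) + (card S - 1) + card Y"
      using degi degb card_miss(1)[of i] card_miss(1)[of b] by linarith
    finally have forb: "card (\<Union>(miss ` e) \<union> (\<lambda>a. \<nu> (a, {i, a})) ` Y) \<le> (card S - 1 + card Y) + (card S - 1) + card Y" .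
    have "card S > 0" using iS fin card_gt_0_iff by blast
    then have "card (\<Union>(miss ` e) \<union> (\<lambda>a. \<nu> (a, {i, a})) ` Y) + card {f \<in> E0. f \<noteq> e \<and> f \<inter> e \<noteq> {}} < 2 * m"
      using forb adj sizeY N(3)[OF NE] unfolding Y_def[symmetric] by linarith
    then show "finite (\<Union>(miss ` e) \<union> (\<lambda>a. \<nu> (a, {i, a})) ` Y) \<and>
        card (\<Union>(miss ` e) \<union> (\<lambda>a. \<nu> (a, {i, a})) ` Y) + card {f \<in> {} \<union> E0. f \<noteq> e \<and> f \<inter> e \<noteq> {}} < card {..<2 * m}"
      using finY card_miss(2) b(1) by simp
  qed (simp_all add: proper_on_def)
  then obtain c0 where c0: "proper_on E0 c0"
    "\<And>e. e \<in> E0 \<Longrightarrow> c0 e \<in> {..<2 * m} - (\<Union>(miss ` e) \<union> (\<lambda>a. \<nu> (a, {i, a})) ` Y)" by auto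
  have "\<exists>col. (\<forall>e\<in>E0. col e = c0 e) \<and> proper_on ([?V]\<^bsup>2\<^esup> - B) col \<and>
    (\<forall>e\<in>[?V]\<^bsup>2\<^esup> - B. col e < 2 * m \<and> (\<forall>w\<in>e. \<forall>b\<in>B. w \<in> b \<longrightarrow> col e \<noteq> \<nu> (w, b)))"
  proof (rule tight_colouring[OF finV cardV W(1,3,2) \<nu> E0 c0(1)])
    fix e assume "e \<in> E0"
    then have "c0 e < 2 * m" "c0 e \<notin> \<Union>(miss ` e)" using c0(2) by auto
    then show "c0 e < 2 * m \<and> (\<forall>w\<in>e. \<forall>b\<in>B. w \<in> b \<longrightarrow> c0 e \<noteq> \<nu> (w, b))"
      unfolding miss_def by blast
  qed
  then obtain col where col': "\<forall>e\<in>E0. col e = c0 e" and colP: "proper_on ([?V]\<^bsup>2\<^esup> - B) col"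
    and colB: "\<forall>e\<in>[?V]\<^bsup>2\<^esup> - B. col e < 2 * m \<and> (\<forall>w\<in>e. \<forall>b\<in>B. w \<in> b \<longrightarrow> col e \<noteq> \<nu> (w, b))"
    by (elim exE conjE)
  have col1: "col e = c0 e" if "e \<in> E0" for e using col' that by simp
  have col3: "col e < 2 * m" if "e \<in> [?V]\<^bsup>2\<^esup> - B" for e using bspec[OF colB that] by simp
  have col4: "col e \<noteq> \<nu> (w, b)" if "e \<in> [?V]\<^bsup>2\<^esup> - B" "w \<in> e" "b \<in> B" "w \<in> b" for e w b
    using bspec[OF colB that(1)] that(2-4) by simp
  define c where "c e = (if e \<in> B then \<nu> (THE u. u \<in> e \<inter> Q, e) else col e)" for e
  have cB: "c {u, s} = \<nu> (u, {u, s})" "c {s, u} = \<nu> (u, {u, s})" if "{u, s} \<in> B" "u \<in> Q" for u s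
  proof -
    have "s \<notin> Q" using that BQ by blast
    then have "(THE w. w \<in> {u, s} \<inter> Q) = u" using that by (intro the_equality) auto
    then show "c {u, s} = \<nu> (u, {u, s})" using that by (simp add: c_def)
    then show "c {s, u} = \<nu> (u, {u, s})" by (simp add: insert_commute)
  qed
  have cN: "c e = col e" if "e \<notin> B" for e using that by (simp add: c_def)
  have pair: "{u, z} \<in> [?V]\<^bsup>2\<^esup> - B" if "u \<in> ?V" "z \<in> ?V" "u \<noteq> z" "{u, z} \<notin> B" for u z
    using that by auto
  have colproper: "col {u, y} \<noteq> col {u, z}"
    if "u \<in> ?V" "y \<in> ?V" "z \<in> ?V" "u \<noteq> y" "u \<noteq> z" "y \<noteq> z" "{u, y} \<notin> B" "{u, z} \<notin> B" for u y z
  proof -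
    have "{u, y} \<noteq> {u, z}" "{u, y} \<inter> {u, z} \<noteq> {}" using that by (auto simp: doubleton_eq_iff)
    then show ?thesis using colP pair that unfolding proper_on_def by metis
  qed
  have r1: "c {u, z} < 2 * m" if "u \<in> Q" "z \<in> ?V - {u}" for u z
  proof (cases "{u, z} \<in> B")
    case True then show ?thesis using cB[OF True that(1)] \<nu>lt by auto
  next
    case False
    then show ?thesis using cN[OF False] col3[OF pair[of u z]] that by auto
  qed
  have r2: "inj_on (\<lambda>z. c {u, z}) (?V - {u})" if u: "u \<in> Q" for u
  proof (rule inj_onI, rule ccontr)
    fix y z assume yz: "y \<in> ?V - {u}" "z \<in> ?V - {u}" "c {u, y} = c {u, z}" "y \<noteq> z"
    have mixed: False if "{u, y'} \<in> B" "{u, z'} \<notin> B" "z' \<in> ?V - {u}" "c {u, y'} = c {u, z'}" for y' z'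
    proof -
      have "col {u, z'} \<noteq> \<nu> (u, {u, y'})" using that u by (intro col4 pair) auto
      then show False using cB(1)[OF that(1) u] cN[OF that(2)] that(4) by simp
    qed
    show False
    proof (cases "{u, y} \<in> B"; cases "{u, z} \<in> B")
      assume "{u, y} \<in> B" "{u, z} \<in> B"
      then have "{u, y} = {u, z}" using \<nu>inj[of u "{u, y}" u "{u, z}"] cB u yz(3) by auto
      then show False using yz(4) by (auto simp: doubleton_eq_iff)
    next
      assume "{u, y} \<notin> B" "{u, z} \<notin> B"
      then show False using colproper[of u y z] cN yz u by auto
    next
      assume "{u, y} \<in> B" "{u, z} \<notin> B"
      then show False using mixed yz by blast
    next
      assume "{u, y} \<notin> B" "{u, z} \<in> B"
      then show False using mixed[of z y] yz by simp
    qed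
  qed
  have r3: "{s, a} \<in> B \<longleftrightarrow> {s, b} \<notin> B"
    if "s \<in> S" "a \<in> Q" "b \<in> Q" "a \<noteq> b" "c {s, a} = c {s, b}" for s a b
  proof (cases "{s, a} \<in> B"; cases "{s, b} \<in> B")
    assume B: "{s, a} \<in> B" "{s, b} \<in> B"
    then have "a = b" using \<nu>inj[of a "{a, s}" b "{b, s}"] cB(2)[of a s] cB(2)[of b s] that
      by (auto simp: insert_commute)
    then show ?thesis using that by blast
  next
    assume B: "{s, a} \<notin> B" "{s, b} \<notin> B"
    have "s \<noteq> a" "s \<noteq> b" using that QS by auto
    then show ?thesis using colproper[of s a b] cN B that by auto
  qed auto
  have r4: "c {i, a} \<noteq> c {i, b}" if "a \<in> Q" "b \<in> N" "{i, a} \<in> B" "{i, b} \<notin> B" for a b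
  proof -
    have "{i, b} \<in> E0" using that by (auto simp: E0_def)
    then have "c {i, b} = c0 {i, b}" "c0 {i, b} \<notin> (\<lambda>a. \<nu> (a, {i, a})) ` Y"
      using cN[OF that(4)] col1 c0(2) by auto
    moreover have "c {i, a} = \<nu> (a, {i, a})" using cB(2)[of a i] that by (simp add: insert_commute)
    moreover have "\<nu> (a, {i, a}) \<in> (\<lambda>a. \<nu> (a, {i, a})) ` Y" using that by (simp add: Y_def)
    ultimately show ?thesis by metis
  qed
  show ?thesis
    by (intro exI[of _ c] conjI ballI impI; (elim conjE)?; rule r1 r2 r3 r4; assumption)
qed

section \<open>Split graphs whose neighbourhoods form two chains\<close>

text \<open>
  A split graph with clique \<open>Q\<close> and stable set \<open>S\<close>, where \<open>N s\<close> is the neighbourhood of \<open>s\<close>.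
\<close>
locale two_chains =
  fixes Q S :: "'a set" and N :: "'a \<Rightarrow> 'a set" and L R :: "'a set"
  assumes fin: "finite Q" "finite S" and QS: "Q \<inter> S = {}"
    and LR: "L \<subseteq> Q" "R \<subseteq> Q" "L \<inter> R = {}"
    and nbrs: "s \<in> S \<Longrightarrow> N s \<subseteq> L \<union> R"
    and chainL: "s \<in> S \<Longrightarrow> t \<in> S \<Longrightarrow> N s \<inter> L \<subseteq> N t \<or> N t \<inter> L \<subseteq> N s"
    and chainR: "s \<in> S \<Longrightarrow> t \<in> S \<Longrightarrow> N s \<inter> R \<subseteq> N t \<or> N t \<inter> R \<subseteq> N s"
begin

definition SL where "SL = {s \<in> S. N s \<inter> L \<noteq> {}}"
definition SR where "SR = {s \<in> S. N s \<inter> R \<noteq> {}}"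
definition edges where "edges = [Q]\<^bsup>2\<^esup> \<union> (\<Union>s\<in>S. (\<lambda>u. {s, u}) ` N s)"

lemma mirror: "two_chains Q S N R L"
proof
  show "N s \<subseteq> R \<union> L" if "s \<in> S" for s using nbrs[OF that] by blast
  show "N s \<inter> R \<subseteq> N t \<or> N t \<inter> R \<subseteq> N s" if "s \<in> S" "t \<in> S" for s t
    using that by (rule chainR)
  show "N s \<inter> L \<subseteq> N t \<or> N t \<inter> L \<subseteq> N s" if "s \<in> S" "t \<in> S" for s t
    using that by (rule chainL)
qed (use fin QS LR in auto)

lemma SL_sub: "SL \<subseteq> S" and SR_sub: "SR \<subseteq> S" by (auto simp: SL_def SR_def)
lemma finSL: "finite SL" and finSR: "finite SR"
  using SL_sub SR_sub fin(2) finite_subset by blast+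
lemma nbrs_Q: "s \<in> S \<Longrightarrow> N s \<subseteq> Q" using nbrs LR by blast
lemma nbrs_L: "s \<in> S \<Longrightarrow> s \<notin> SR \<Longrightarrow> N s \<subseteq> L" using nbrs by (fastforce simp: SR_def)
lemma nbrs_R: "s \<in> S \<Longrightarrow> s \<notin> SL \<Longrightarrow> N s \<subseteq> R" using nbrs by (fastforce simp: SL_def)

lemma edges_sub: "edges \<subseteq> [Q \<union> S]\<^bsup>2\<^esup>"
proof
  fix e assume "e \<in> edges"
  then consider "e \<in> [Q]\<^bsup>2\<^esup>" | s u where "s \<in> S" "u \<in> N s" "e = {s, u}" by (auto simp: edges_def)
  then show "e \<in> [Q \<union> S]\<^bsup>2\<^esup>"
  proof cases
    case 1 then show ?thesis using nsets_mono[of Q "Q \<union> S" 2] by auto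
  next
    case 2
    then have "u \<in> Q" using nbrs_Q by blast
    then have "s \<noteq> u" using 2 QS by blast
    then show ?thesis using 2 \<open>u \<in> Q\<close> by simp
  qed
qed

lemma edge_iff:
  "{v, y} \<in> edges \<longleftrightarrow> v \<in> Q \<and> y \<in> Q \<and> v \<noteq> y \<or> v \<in> S \<and> y \<in> N v \<or> y \<in> S \<and> v \<in> N y"
proof -
  have "{v, y} \<in> (\<Union>s\<in>S. (\<lambda>u. {s, u}) ` N s) \<longleftrightarrow> v \<in> S \<and> y \<in> N v \<or> y \<in> S \<and> v \<in> N y"
    by (auto simp: doubleton_eq_iff image_iff)
  then show ?thesis unfolding edges_def by simp
qed

text \<open>
  A map that is injective on the neighbourhood of every vertex pulls proper colourings back. The colouring
  \<open>c\<close> need not be proper at the vertices of \<open>T\<close>: only clashes that become visible at a single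
  stable vertex matter.
\<close>
lemma colouring_by_identification:
  assumes T: "Q \<inter> T = {}" and \<pi>: "bij_betw \<pi> Q Q"
    and \<tau>: "\<And>s. s \<in> S \<Longrightarrow> N s \<noteq> {} \<Longrightarrow> \<tau> s \<in> T"
      "\<And>s t u. s \<in> S \<Longrightarrow> t \<in> S \<Longrightarrow> u \<in> N s \<Longrightarrow> u \<in> N t \<Longrightarrow> \<tau> s = \<tau> t \<Longrightarrow> s = t"
    and c: "\<forall>u\<in>Q. \<forall>z\<in>Q \<union> T - {u}. c {u, z} < k" "\<forall>u\<in>Q. inj_on (\<lambda>z. c {u, z}) (Q \<union> T - {u})"
      "\<And>s a b. s \<in> S \<Longrightarrow> a \<in> N s \<Longrightarrow> b \<in> N s \<Longrightarrow> a \<noteq> b \<Longrightarrow> c {\<tau> s, \<pi> a} \<noteq> c {\<tau> s, \<pi> b}"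
  shows "\<exists>col. proper_edge_colouring edges k col"
proof -
  define \<psi> where "\<psi> v = (if v \<in> Q then \<pi> v else \<tau> v)" for v
  define col where "col e = c (\<psi> ` e)" for e
  have \<pi>Q: "\<pi> v \<in> Q" if "v \<in> Q" for v using \<pi> that by (auto simp: bij_betw_def)
  have \<pi>inj: "\<pi> a = \<pi> b \<Longrightarrow> a = b" if "a \<in> Q" "b \<in> Q" for a b
    using \<pi> that by (auto simp: bij_betw_def inj_on_eq_iff)
  have \<psi>Q: "\<psi> v = \<pi> v" if "v \<in> Q" for v using that by (simp add: \<psi>_def)
  have \<psi>S: "\<psi> s = \<tau> s" if "s \<in> S" for s using that QS by (auto simp: \<psi>_def)
  have nbr: "\<psi> y \<in> Q \<union> T - {\<psi> v}" if vQ: "v \<in> Q" and vy: "{v, y} \<in> edges" for v y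
  proof -
    have "v \<notin> S" using vQ QS by blast
    then consider "y \<in> Q" "v \<noteq> y" | "y \<in> S" "v \<in> N y"
      using vy unfolding edge_iff by blast
    then show ?thesis
    proof cases
      case 1 then show ?thesis using \<psi>Q \<pi>Q \<pi>inj[of y v] vQ by auto
    next
      case 2
      then have "\<tau> y \<in> T" using \<tau>(1) by blast
      then show ?thesis using \<psi>S[OF 2(1)] \<psi>Q[OF vQ] \<pi>Q[OF vQ] T by auto
    qed
  qed
  have proper: "proper_on edges col"
  proof (rule proper_on_pairsI[OF edges_sub])
    fix v y z assume vy: "{v, y} \<in> edges" and vz: "{v, z} \<in> edges" and yz: "y \<noteq> z"
    have "v \<in> Q \<or> v \<in> S" using vy edges_sub by (auto dest: subsetD)
    then show "col {v, y} \<noteq> col {v, z}"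
    proof
      assume v: "v \<in> Q"
      have "\<psi> y \<noteq> \<psi> z"
      proof
        assume eq: "\<psi> y = \<psi> z"
        consider "y \<in> Q" "z \<in> Q" | "y \<in> Q" "z \<in> S" "v \<in> N z" | "y \<in> S" "v \<in> N y" "z \<in> Q"
          | "y \<in> S" "z \<in> S" "v \<in> N y" "v \<in> N z"
        proof -
          have "v \<notin> S" using v QS by blast
          then have "y \<in> Q \<or> y \<in> S \<and> v \<in> N y" "z \<in> Q \<or> z \<in> S \<and> v \<in> N z"
            using vy vz unfolding edge_iff by blast+
          then show thesis using that by blast
        qed
        then show False
        proof cases
          case 1 then show False using eq \<psi>Q \<pi>inj yz by auto
        next
          case 2
          then have "\<tau> z \<in> T" using \<tau>(1) by blast
          then show False using 2 eq \<psi>Q[of y] \<pi>Q[of y] \<psi>S[of z] T by auto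
        next
          case 3
          then have "\<tau> y \<in> T" using \<tau>(1) by blast
          then show False using 3 eq \<psi>Q[of z] \<pi>Q[of z] \<psi>S[of y] T by auto
        next
          case 4 then show False using eq \<psi>S \<tau>(2)[of y z v] yz by simp
        qed
      qed
      then show ?thesis
        using inj_onD[OF bspec[OF c(2) \<pi>Q[OF v]], of "\<psi> y" "\<psi> z"] nbr[OF v vy] nbr[OF v vz] \<psi>Q[OF v]
        by (auto simp: col_def)
    next
      assume v: "v \<in> S"
      then have "y \<in> N v" "z \<in> N v" using vy vz QS nbrs_Q by (auto simp: edge_iff)
      moreover have "y \<in> Q" "z \<in> Q" using calculation nbrs_Q[OF v] by auto
      ultimately show ?thesis using c(3)[OF v _ _ yz] \<psi>S[OF v] \<psi>Q by (simp add: col_def)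
    qed
  qed
  have "col e < k" if e: "e \<in> edges" for e
  proof -
    obtain v y where vy: "e = {v, y}" "v \<in> Q"
      using e nbrs_Q by (auto simp: edges_def nsets_2_eq)
    then show ?thesis using c(1) nbr[of v y] e \<psi>Q[of v] \<pi>Q[of v] by (auto simp: col_def)
  qed
  then have "col ` edges \<subseteq> {..<k}" by auto
  then show ?thesis using proper unfolding proper_on_def proper_edge_colouring_def by blast
qed

lemma identification_exists:
  assumes "card SR \<le> card SL"
  obtains j where "inj_on j (SR - SL)" "j ` (SR - SL) \<subseteq> SL - SR"
proof -
  have "card (SR - SL) + card (SR \<inter> SL) = card SR" "card (SL - SR) + card (SR \<inter> SL) = card SL"
    using finSL finSR by (metis Int_commute add.commute card_Int_Diff)+
  then have "card (SR - SL) \<le> card (SL - SR)" using assms by linarith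
  then show thesis using that finSL finSR by (metis card_le_inj finite_Diff)
qed

definition identify where "identify j s = (if s \<in> SL then s else j s)"

text \<open>
  Vertices of \<open>SR - SL\<close> have neighbours only in \<open>R\<close>, and those of \<open>SL - SR\<close> only in \<open>L\<close>, so identified
  vertices have no common neighbour.
\<close>
lemma identify_props:
  assumes "inj_on j (SR - SL)" "j ` (SR - SL) \<subseteq> SL - SR"
  shows "s \<in> S \<Longrightarrow> N s \<noteq> {} \<Longrightarrow> identify j s \<in> SL"
    and "s \<in> S \<Longrightarrow> t \<in> S \<Longrightarrow> u \<in> N s \<Longrightarrow> u \<in> N t \<Longrightarrow> identify j s = identify j t \<Longrightarrow> s = t"
proof -
  have R: "s \<in> SR - SL" if "s \<in> S" "s \<notin> SL" "N s \<noteq> {}" for s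
    using that nbrs by (fastforce simp: SL_def SR_def)
  then show "s \<in> S \<Longrightarrow> N s \<noteq> {} \<Longrightarrow> identify j s \<in> SL" using assms(2) by (auto simp: identify_def)
  assume st: "s \<in> S" "t \<in> S" "u \<in> N s" "u \<in> N t" "identify j s = identify j t"
  have mixed: False if "s \<in> S" "t \<in> S" "u \<in> N s" "u \<in> N t" "identify j s = identify j t" "s \<in> SL" "t \<notin> SL" for s t
  proof -
    have "t \<in> SR - SL" using R that by blast
    then have "j t \<notin> SR" "u \<in> R" using assms(2) nbrs_R[of t] that by auto
    moreover have "s \<in> SR" using that \<open>u \<in> R\<close> by (auto simp: SR_def)
    ultimately show False using that by (simp add: identify_def)
  qed
  show "s = t"
  proof (cases "s \<in> SL"; cases "t \<in> SL")
    assume "s \<in> SL" "t \<in> SL" then show ?thesis using st by (simp add: identify_def)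
  next
    assume "s \<notin> SL" "t \<notin> SL"
    then have "s \<in> SR - SL" "t \<in> SR - SL" "j s = j t" using st R by (auto simp: identify_def)
    then show ?thesis using inj_onD[OF assms(1)] by blast
  next
    assume "s \<in> SL" "t \<notin> SL" then show ?thesis using mixed[of s t] st by simp
  next
    assume "s \<notin> SL" "t \<in> SL" then show ?thesis using mixed[of t s] st by simp
  qed
qed

text \<open>
  The three alternatives in the last assumption are the ways to avoid a clash at a
  vertex \<open>s\<close> represented by \<open>j s\<close>.
\<close>
lemma colouring_from_deleted_pairs:
  assumes j: "inj_on j (SR - SL)" "j ` (SR - SL) \<subseteq> SL - SR"
    and m: "card Q + card SL = 2 * m + 1"
    and W: "W \<subseteq> Q \<union> SL" "card W \<le> m + 1" "B \<subseteq> [W]\<^bsup>2\<^esup>" "card B = m"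
    and BQ: "\<And>a b. a \<in> Q \<Longrightarrow> b \<in> Q \<Longrightarrow> {a, b} \<notin> B"
    and H: "H \<subseteq> W \<inter> Q" "H \<noteq> {} \<Longrightarrow> i \<in> SL \<inter> W"
      "H \<noteq> {} \<Longrightarrow> 2 * card SL + card {a \<in> Q. {i, a} \<in> B} + card (W \<inter> Q) < 2 * m + 3"
    and nonedge: "\<And>s a. s \<in> SL \<Longrightarrow> a \<in> N s \<Longrightarrow> {s, a} \<notin> B"
    and folded: "\<And>s. s \<in> SR - SL \<Longrightarrow> (\<forall>a\<in>N s. {j s, a} \<in> B) \<or> (\<forall>a\<in>N s. {j s, a} \<notin> B) \<or> j s = i \<and> N s \<subseteq> H"
  shows "\<exists>col. proper_edge_colouring edges (2 * m) col"
proof -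
  have QSL: "Q \<inter> SL = {}" using QS SL_sub by blast
  obtain c where c: "\<forall>u\<in>Q. \<forall>z\<in>Q \<union> SL - {u}. c {u, z} < 2 * m"
    "\<forall>u\<in>Q. inj_on (\<lambda>z. c {u, z}) (Q \<union> SL - {u})"
    "\<forall>s\<in>SL. \<forall>a\<in>Q. \<forall>b\<in>Q. a \<noteq> b \<and> c {s, a} = c {s, b} \<longrightarrow> ({s, a} \<in> B \<longleftrightarrow> {s, b} \<notin> B)"
    "\<forall>a\<in>Q. \<forall>b\<in>H. {i, a} \<in> B \<and> {i, b} \<notin> B \<longrightarrow> c {i, a} \<noteq> c {i, b}"
  proof -
    have "\<exists>c. (\<forall>u\<in>Q. \<forall>z\<in>Q \<union> SL - {u}. c {u, z} < 2 * m) \<and>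
      (\<forall>u\<in>Q. inj_on (\<lambda>z. c {u, z}) (Q \<union> SL - {u})) \<and>
      (\<forall>s\<in>SL. \<forall>a\<in>Q. \<forall>b\<in>Q. a \<noteq> b \<and> c {s, a} = c {s, b} \<longrightarrow> ({s, a} \<in> B \<longleftrightarrow> {s, b} \<notin> B)) \<and>
      (\<forall>a\<in>Q. \<forall>b\<in>H. {i, a} \<in> B \<and> {i, b} \<notin> B \<longrightarrow> c {i, a} \<noteq> c {i, b})"
      by (rule split_join_colouring[where W = W]; fact fin(1) finSL QSL m W BQ H)
    then show thesis using that by (elim exE conjE)
  qed
  show ?thesis
  proof (rule colouring_by_identification[of SL id "identify j" c])
    show "Q \<inter> SL = {}" by (rule QSL)
    show "bij_betw id Q Q" by simp
    fix s a b assume s: "s \<in> S" and ab: "a \<in> N s" "b \<in> N s" "a \<noteq> b"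
    have abQ: "a \<in> Q" "b \<in> Q" using ab nbrs_Q[OF s] by auto
    have t: "identify j s \<in> SL" using identify_props(1)[OF j s] ab by blast
    have "c {identify j s, a} \<noteq> c {identify j s, b}"
    proof
      assume eq: "c {identify j s, a} = c {identify j s, b}"
      then have iff: "{identify j s, a} \<in> B \<longleftrightarrow> {identify j s, b} \<notin> B" using c(3) t abQ ab(3) by blast
      show False
      proof (cases "s \<in> SL")
        case True then show False using iff nonedge ab by (simp add: identify_def)
      next
        case False
        then have "s \<in> SR - SL" using s ab nbrs_R[OF s] by (auto simp: SR_def)
        moreover have f: "identify j s = j s" using False by (simp add: identify_def)
        ultimately have "j s = i" "a \<in> H" "b \<in> H" using folded[of s] iff ab by auto
        then show False using c(4) iff eq f abQ by metis
      qed
    qed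
    then show "c {identify j s, id a} \<noteq> c {identify j s, id b}" by simp
  qed (use identify_props[OF j] c in auto)
qed

end

section \<open>Choosing the pairs to delete\<close>

lemma card_all_pairs:
  assumes "finite A"
  shows "2 * card ([A]\<^bsup>2\<^esup>) + card A = card A * card A"
proof -
  have "[A]\<^bsup>2\<^esup> = {B. B \<subseteq> A \<and> card B = 2}"
    using assms finite_subset by (auto simp: nsets_def)
  then have "card ([A]\<^bsup>2\<^esup>) = card A choose 2" using n_subsets[OF assms] by simp
  then have "card ([A]\<^bsup>2\<^esup>) = card A * (card A - 1) div 2" by (simp add: choose_two)
  moreover have "even (card A * (card A - 1))" by (cases "card A") auto
  ultimately have "2 * card ([A]\<^bsup>2\<^esup>) = card A * (card A - 1)" by simp
  then show ?thesis by (cases "card A") auto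
qed

text \<open>
  Used to relabel the clique so that the vertices which clash with \<open>U\<close> go to harmless places.
\<close>
lemma permutation_moving:
  assumes "finite Q" "U \<subseteq> Q" "X \<subseteq> Q - U" "A \<subseteq> Q - U" "card X = card A"
  obtains \<pi> where "bij_betw \<pi> Q Q" "\<And>v. v \<in> Q \<Longrightarrow> \<pi> v \<in> U \<longleftrightarrow> v \<in> U" "\<And>v. v \<in> Q \<Longrightarrow> \<pi> v \<in> A \<Longrightarrow> v \<in> X"
proof -
  have fin: "finite X" "finite A" "finite U" using assms finite_subset by blast+
  obtain f where f: "bij_betw f X A" using finite_same_card_bij[OF fin(1,2) assms(5)] by blast
  have "card (Q - U - X) = card (Q - U - A)"
    using assms fin by (simp add: card_Diff_subset)
  then obtain g where g: "bij_betw g (Q - U - X) (Q - U - A)"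
    using finite_same_card_bij assms(1) by (metis finite_Diff)
  define \<pi> where "\<pi> v = (if v \<in> U then v else if v \<in> X then f v else g v)" for v
  have 1: "bij_betw \<pi> U U"
    using bij_betw_cong[of U \<pi> id U] by (simp add: \<pi>_def)
  have 2: "bij_betw \<pi> X A"
    using f assms(3) by (subst bij_betw_cong[of X \<pi> f A]) (auto simp: \<pi>_def)
  have 3: "bij_betw \<pi> (Q - U - X) (Q - U - A)"
    using g by (subst bij_betw_cong[of _ \<pi> g]) (auto simp: \<pi>_def)
  have "bij_betw \<pi> (U \<union> X \<union> (Q - U - X)) (U \<union> A \<union> (Q - U - A))"
    using assms(4) by (intro bij_betw_combine 1 2 3) auto
  moreover have "U \<union> X \<union> (Q - U - X) = Q" "U \<union> A \<union> (Q - U - A) = Q" using assms by auto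
  ultimately have bij: "bij_betw \<pi> Q Q" by simp
  have split: "\<pi> v \<in> U \<and> v \<in> U \<or> \<pi> v \<in> A \<and> v \<in> X \<or> \<pi> v \<in> Q - U - A \<and> v \<in> Q - U - X" if "v \<in> Q" for v
    using bij_betwE[OF 1] bij_betwE[OF 2] bij_betwE[OF 3] that by blast
  show thesis
  proof (rule that[OF bij])
    show "\<pi> v \<in> U \<longleftrightarrow> v \<in> U" if "v \<in> Q" for v using split[OF that] assms(3,4) by blast
    show "v \<in> X" if "v \<in> Q" "\<pi> v \<in> A" for v using split[OF that(1)] that(2) assms(4) by blast
  qed
qed

lemma chain_has_greatest:
  assumes "finite I" "I \<noteq> {}" "\<And>i j. i \<in> I \<Longrightarrow> j \<in> I \<Longrightarrow> F i \<subseteq> F j \<or> F j \<subseteq> F i"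
  shows "\<exists>k\<in>I. \<forall>i\<in>I. F i \<subseteq> F k"
  using assms
proof (induction I rule: finite_ne_induct)
  case (insert i I)
  then obtain k where k: "k \<in> I" "\<forall>i\<in>I. F i \<subseteq> F k" by blast
  from insert.prems[of i k] k show ?case by blast
qed auto

lemma fill_up_to:
  fixes F :: "'i \<Rightarrow> 'b set" and x :: nat
  assumes "finite I" "x < (\<Sum>i\<in>I. card (F i))"
  shows "\<exists>J k Y. J \<subseteq> I \<and> k \<in> I - J \<and> Y \<subseteq> F k \<and> (\<Sum>i\<in>J. card (F i)) + card Y = x"
  using assms
proof (induction I rule: finite_induct)
  case (insert i I)
  show ?case
  proof (cases "x < (\<Sum>i\<in>I. card (F i))")
    case True
    then obtain J k Y where "J \<subseteq> I" "k \<in> I - J" "Y \<subseteq> F k" "(\<Sum>i\<in>J. card (F i)) + card Y = x"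
      using insert.IH by blast
    then show ?thesis by (intro exI[of _ J] exI[of _ k] exI[of _ Y]) auto
  next
    case False
    then have "x - (\<Sum>i\<in>I. card (F i)) \<le> card (F i)" using insert by simp
    then obtain Y where Y: "Y \<subseteq> F i" "card Y = x - (\<Sum>i\<in>I. card (F i))"
      using obtain_subset_with_card_n by metis
    then show ?thesis
      using False insert.hyps by (intro exI[of _ I] exI[of _ i] exI[of _ Y]) auto
  qed
qed simp

lemma obtain_set_between:
  assumes "finite T" "A \<subseteq> T" "card A \<le> x" "x \<le> card T"
  obtains M where "A \<subseteq> M" "M \<subseteq> T" "card M = x"
proof -
  have finA: "finite A" using assms finite_subset by blast
  have "x - card A \<le> card (T - A)" using assms finA by (simp add: card_Diff_subset)
  then obtain D where D: "D \<subseteq> T - A" "card D = x - card A" "finite D"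
    using obtain_subset_with_card_n by metis
  have "card (A \<union> D) = card A + card D" using D finA by (intro card_Un_disjoint) auto
  then show thesis using that[of "A \<union> D"] D assms by auto
qed

context two_chains
begin

text \<open>
  A member \<open>(s, a)\<close> of \<open>M\<close> stands for the pair \<open>{s, a}\<close>; the order tells the stable vertex from the
  clique vertex.
\<close>
definition missing_edges where
  "missing_edges M = [SL]\<^bsup>2\<^esup> \<union> (\<lambda>(s, a). {s, a}) ` M"

text \<open>
  The equation for \<open>x\<close> says that \<open>x\<close> pairs between \<open>SL\<close> and \<open>Q\<close> complete the pairs inside \<open>SL\<close> to
  exactly \<open>m\<close> pairs. The set \<open>H\<close> contains the clique vertices to which the greedy part of the
  construction applies; the estimates rest on \<open>(k - 1) * (k - 2) \<ge> 0\<close> for \<open>k = card SL\<close>.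
\<close>
lemma missing_edges_props:
  assumes m: "card Q + card SL = 2 * m + 1"
    and x: "card Q + 2 * card SL = card SL * card SL + 1 + 2 * x"
    and M: "M \<subseteq> SL \<times> Q" "card M = x" and H: "H \<subseteq> Q" "snd ` M \<subseteq> H" "card H \<le> x"
  shows "SL \<union> H \<subseteq> Q \<union> SL" "card (SL \<union> H) \<le> m + 1" "missing_edges M \<subseteq> [SL \<union> H]\<^bsup>2\<^esup>"
    "card (missing_edges M) = m"
    "\<And>s a. s \<in> SL \<Longrightarrow> a \<in> Q \<Longrightarrow> {s, a} \<in> missing_edges M \<longleftrightarrow> (s, a) \<in> M"
    "\<And>a b. a \<in> Q \<Longrightarrow> b \<in> Q \<Longrightarrow> {a, b} \<notin> missing_edges M"
    "(SL \<union> H) \<inter> Q = H"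
    "2 * card SL + x + card H < 2 * m + 3"
proof -
  have QSL: "Q \<inter> SL = {}" using QS SL_sub by blast
  have quad: "3 * card SL \<le> card SL * card SL + 2"
  proof -
    consider "card SL = 0" | "card SL = 1" | "card SL = 2" | "3 \<le> card SL" by linarith
    then show ?thesis
    proof cases
      case 4
      then have "3 * card SL \<le> card SL * card SL" by (rule mult_le_mono1)
      then show ?thesis by (rule trans_le_add1)
    qed auto
  qed
  show "SL \<union> H \<subseteq> Q \<union> SL" using H by blast
  have "card (SL \<union> H) \<le> card SL + card H" by (rule card_Un_le)
  then show "card (SL \<union> H) \<le> m + 1" using quad m x H(3) by linarith
  show "2 * card SL + x + card H < 2 * m + 3" using quad m x H(3) by linarith
  show "missing_edges M \<subseteq> [SL \<union> H]\<^bsup>2\<^esup>"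
    unfolding missing_edges_def
  proof (intro Un_least image_subsetI)
    show "[SL]\<^bsup>2\<^esup> \<subseteq> [SL \<union> H]\<^bsup>2\<^esup>" by (intro nsets_mono) blast
    fix p assume p: "p \<in> M"
    obtain s a where sa: "p = (s, a)" by (cases p)
    have "s \<in> SL" "a \<in> Q" using p sa M(1) by auto
    moreover have "a \<in> H" using H(2) p sa by force
    moreover have "s \<noteq> a" using calculation QSL by blast
    ultimately show "(case p of (s, a) \<Rightarrow> {s, a}) \<in> [SL \<union> H]\<^bsup>2\<^esup>" by (simp add: sa)
  qed
  show iff: "{s, a} \<in> missing_edges M \<longleftrightarrow> (s, a) \<in> M" if "s \<in> SL" "a \<in> Q" for s a
  proof -
    have "a \<notin> SL" "s \<notin> Q" using that QSL by auto
    then show ?thesis using M(1) that by (auto simp: missing_edges_def doubleton_eq_iff)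
  qed
  show "{a, b} \<notin> missing_edges M" if "a \<in> Q" "b \<in> Q" for a b
  proof -
    have "a \<notin> SL" "b \<notin> SL" using that QSL by auto
    then show ?thesis using M(1) that by (auto simp: missing_edges_def doubleton_eq_iff)
  qed
  show "(SL \<union> H) \<inter> Q = H" using QSL H(1) by blast
  have finM: "finite M" using M(1) finSL fin(1) by (meson finite_SigmaI finite_subset)
  have inj: "inj_on (\<lambda>(s, a). {s, a}) M"
  proof (rule inj_onI)
    fix p q assume pq: "p \<in> M" "q \<in> M" "(case p of (s, a) \<Rightarrow> {s, a}) = (case q of (s, a) \<Rightarrow> {s, a})"
    obtain s a t b where "p = (s, a)" "q = (t, b)" by (cases p; cases q)
    moreover from this have "s \<in> SL" "t \<in> SL" "a \<in> Q" "b \<in> Q" using pq M(1) by auto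
    ultimately show "p = q" using pq(3) QSL by (auto simp: doubleton_eq_iff)
  qed
  have disj: "[SL]\<^bsup>2\<^esup> \<inter> (\<lambda>(s, a). {s, a}) ` M = {}"
  proof -
    have "{s, a} \<notin> [SL]\<^bsup>2\<^esup>" if "(s, a) \<in> M" for s a
    proof -
      have "a \<in> Q" using that M(1) by auto
      then show ?thesis using QSL by auto
    qed
    then show ?thesis by auto
  qed
  have "card (missing_edges M) = card ([SL]\<^bsup>2\<^esup>) + card ((\<lambda>(s, a). {s, a}) ` M)"
    unfolding missing_edges_def
    by (rule card_Un_disjoint[OF finite_imp_finite_nsets[OF finSL] finite_imageI[OF finM] disj])
  then have "card (missing_edges M) = card ([SL]\<^bsup>2\<^esup>) + x" using card_image[OF inj] M(2) by simp
  then show "card (missing_edges M) = m" using card_all_pairs[OF finSL] m x by linarith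
qed

lemma colouring_from_missing_pairs:
  assumes j: "inj_on j (SR - SL)" "j ` (SR - SL) \<subseteq> SL - SR"
    and m: "card Q + card SL = 2 * m + 1"
    and x: "card Q + 2 * card SL = card SL * card SL + 1 + 2 * x"
    and M: "M \<subseteq> SL \<times> Q" "card M = x" and H: "H \<subseteq> Q" "snd ` M \<subseteq> H" "card H \<le> x"
    and nonedge: "\<And>s a. (s, a) \<in> M \<Longrightarrow> a \<notin> N s"
    and K: "K \<subseteq> H" "K \<noteq> {} \<Longrightarrow> i \<in> SL"
    and paired: "\<And>s. s \<in> SR - SL \<Longrightarrow> (\<forall>a\<in>N s. (j s, a) \<in> M) \<or> (\<forall>a\<in>N s. (j s, a) \<notin> M) \<or> j s = i \<and> N s \<subseteq> K"
  shows "\<exists>col. proper_edge_colouring edges (2 * m) col"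
proof (rule colouring_from_deleted_pairs[OF j m, of "SL \<union> H" "missing_edges M" K i])
  note B = missing_edges_props[OF m x M H]
  show "SL \<union> H \<subseteq> Q \<union> SL" "card (SL \<union> H) \<le> m + 1" "missing_edges M \<subseteq> [SL \<union> H]\<^bsup>2\<^esup>"
    "card (missing_edges M) = m" by (fact B)+
  show "{a, b} \<notin> missing_edges M" if "a \<in> Q" "b \<in> Q" for a b using that by (rule B(6))
  show "K \<subseteq> (SL \<union> H) \<inter> Q" using B(7) K(1) by simp
  show "i \<in> SL \<inter> (SL \<union> H)" if "K \<noteq> {}" using K(2)[OF that] by blast
  show "2 * card SL + card {a \<in> Q. {i, a} \<in> missing_edges M} + card ((SL \<union> H) \<inter> Q) < 2 * m + 3"
    if "K \<noteq> {}"
  proof -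
    have "finite M" using M(1) finSL fin(1) by (meson finite_SigmaI finite_subset)
    moreover have "{a \<in> Q. {i, a} \<in> missing_edges M} \<subseteq> snd ` M"
      using B(5)[OF K(2)[OF that]] by force
    ultimately have "card {a \<in> Q. {i, a} \<in> missing_edges M} \<le> card M"
      by (meson card_image_le card_mono finite_imageI le_trans)
    then show ?thesis using B(7,8) M(2) by simp
  qed
  show "{s, a} \<notin> missing_edges M" if "s \<in> SL" "a \<in> N s" for s a
    using B(5)[OF that(1)] nonedge that nbrs_Q SL_sub by blast
  fix s assume s: "s \<in> SR - SL"
  then have "j s \<in> SL" "N s \<subseteq> Q" using j(2) nbrs_Q SR_sub by auto
  then have "{j s, a} \<in> missing_edges M \<longleftrightarrow> (j s, a) \<in> M" if "a \<in> N s" for a using B(5) that by blast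
  then show "(\<forall>a\<in>N s. {j s, a} \<in> missing_edges M) \<or> (\<forall>a\<in>N s. {j s, a} \<notin> missing_edges M) \<or> j s = i \<and> N s \<subseteq> K"
    using paired[OF s] by blast
qed

text \<open>
  Here the pairs inside \<open>SL\<close> alone are numerous enough, so no pair that meets \<open>Q\<close> is deleted and no clash arises.
\<close>
lemma colouring_many_stable_vertices:
  assumes j: "inj_on j (SR - SL)" "j ` (SR - SL) \<subseteq> SL - SR"
    and m: "card Q + card SL = 2 * m + 1"
    and few: "card Q + 2 * card SL \<le> card SL * card SL + 1"
  shows "\<exists>col. proper_edge_colouring edges (2 * m) col"
proof -
  have QSL: "Q \<inter> SL = {}" using QS SL_sub by blast
  obtain A where A: "A \<subseteq> SL" "card A \<le> m + 1" "m \<le> card ([A]\<^bsup>2\<^esup>)"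
  proof (cases "m + 1 \<le> card SL")
    case True
    then obtain A where A: "A \<subseteq> SL" "card A = m + 1" "finite A" using obtain_subset_with_card_n by metis
    have "m \<le> card ([A]\<^bsup>2\<^esup>)" using card_all_pairs[OF A(3)] A(2) by (cases m) auto
    then show thesis using that[of A] A by simp
  next
    case False
    then have "m \<le> card ([SL]\<^bsup>2\<^esup>)" "card SL \<le> m + 1" using card_all_pairs[OF finSL] m few by linarith+
    then show thesis using that[of SL] by blast
  qed
  have finA: "finite A" using A(1) finSL finite_subset by blast
  obtain B where B: "B \<subseteq> [A]\<^bsup>2\<^esup>" "card B = m" using A(3) obtain_subset_with_card_n by metis
  have notQ: "{a, b} \<notin> B" if "b \<in> Q" for a b
  proof
    assume "{a, b} \<in> B"
    then have "{a, b} \<in> [A]\<^bsup>2\<^esup>" using B(1) by blast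
    then have "b \<in> A" by simp
    then show False using that A(1) QSL by blast
  qed
  show ?thesis
  proof (rule colouring_from_deleted_pairs[OF j m, of A B "{}" undefined])
    show "A \<subseteq> Q \<union> SL" using A by blast
    show "\<And>s a. s \<in> SL \<Longrightarrow> a \<in> N s \<Longrightarrow> {s, a} \<notin> B" using notQ nbrs_Q SL_sub by blast
    show "\<And>s. s \<in> SR - SL \<Longrightarrow> (\<forall>a\<in>N s. {j s, a} \<in> B) \<or> (\<forall>a\<in>N s. {j s, a} \<notin> B) \<or> j s = undefined \<and> N s \<subseteq> {}"
      using notQ nbrs_Q SR_sub by blast
  qed (use A B notQ in auto)
qed

text \<open>
  If neither \<open>N (j r)\<close> nor \<open>N r\<close> is large, all \<open>x\<close> pairs are deleted at the single vertex \<open>j r\<close>. Each of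
  the \<open>x\<close> vertices \<open>U0\<close> of these pairs clashes with at most one other vertex of \<open>Q\<close>, and these
  partners form \<open>A\<close>. After a permutation of \<open>Q\<close>, the neighbourhood of \<open>j r\<close> avoids \<open>U0\<close> and
  that of \<open>r\<close> avoids \<open>A\<close>.
\<close>
lemma colouring_one_stable_vertex:
  assumes j: "inj_on j (SR - SL)" "j ` (SR - SL) \<subseteq> SL - SR"
    and m: "card Q + card SL = 2 * m + 1"
    and x: "card Q + 2 * card SL = card SL * card SL + 1 + 2 * x"
    and r: "r \<in> SR - SL" "card (N (j r)) + x \<le> card Q" "card (N r) + x \<le> card Q"
  shows "\<exists>col. proper_edge_colouring edges (2 * m) col"
proof -
  have QSL: "Q \<inter> SL = {}" using QS SL_sub by blast
  have jr: "j r \<in> SL" "j r \<notin> SR" "r \<in> S" "j r \<in> S" using j(2) r(1) SR_sub SL_sub by auto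
  have NQ: "N (j r) \<subseteq> Q" "N r \<subseteq> Q" using nbrs_Q jr by auto
  have disj: "N (j r) \<inter> N r = {}" using nbrs_L[of "j r"] nbrs_R[of r] jr r(1) LR(3) by blast
  have x2: "2 * x \<le> card Q"
  proof -
    have "2 * card SL \<le> card SL * card SL + 1" by (cases "card SL"; cases "card SL - 1") auto
    then show ?thesis using x by linarith
  qed
  obtain U where U: "N r \<subseteq> U" "U \<subseteq> Q - N (j r)" "x \<le> card U" "x \<le> card (Q - U)"
  proof (cases "x \<le> card (N r)")
    case True
    moreover have "x \<le> card (Q - N r)"
      using NQ(2) r(3) finite_subset[OF NQ(2) fin(1)] by (simp add: card_Diff_subset)
    ultimately show thesis using that[of "N r"] disj NQ(2) by blast
  next
    case False
    have "x \<le> card (Q - N (j r))" using r(2) NQ fin(1) finite_subset by (subst card_Diff_subset) auto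
    then obtain U where "N r \<subseteq> U" "U \<subseteq> Q - N (j r)" "card U = x"
    proof -
      have "finite (Q - N (j r))" "N r \<subseteq> Q - N (j r)" "card (N r) \<le> x" using fin(1) NQ disj False by auto
      then show thesis using \<open>x \<le> card (Q - N (j r))\<close> that by (rule obtain_set_between)
    qed
    moreover from this have "finite U" "U \<subseteq> Q" using fin(1) finite_subset by blast+
    ultimately show thesis using that[of U] x2 by (simp add: card_Diff_subset)
  qed
  obtain U0 where U0: "U0 \<subseteq> U" "card U0 = x" "finite U0" using U(3) obtain_subset_with_card_n by metis
  define M where "M = {j r} \<times> U0"
  have M: "M \<subseteq> SL \<times> Q" "card M = x" using jr U0 U by (auto simp: M_def card_cartesian_product)
  have H: "U0 \<subseteq> Q" "snd ` M \<subseteq> U0" "card U0 \<le> x" using U0 U by (auto simp: M_def)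
  note B = missing_edges_props[OF m x M H]
  obtain c where c: "\<forall>u\<in>Q. \<forall>z\<in>Q \<union> SL - {u}. c {u, z} < 2 * m"
    "\<forall>u\<in>Q. inj_on (\<lambda>z. c {u, z}) (Q \<union> SL - {u})"
    "\<forall>s\<in>SL. \<forall>a\<in>Q. \<forall>b\<in>Q. a \<noteq> b \<and> c {s, a} = c {s, b} \<longrightarrow> ({s, a} \<in> missing_edges M \<longleftrightarrow> {s, b} \<notin> missing_edges M)"
  proof -
    have "\<exists>c. (\<forall>u\<in>Q. \<forall>z\<in>Q \<union> SL - {u}. c {u, z} < 2 * m) \<and>
      (\<forall>u\<in>Q. inj_on (\<lambda>z. c {u, z}) (Q \<union> SL - {u})) \<and>
      (\<forall>s\<in>SL. \<forall>a\<in>Q. \<forall>b\<in>Q. a \<noteq> b \<and> c {s, a} = c {s, b} \<longrightarrow> ({s, a} \<in> missing_edges M \<longleftrightarrow> {s, b} \<notin> missing_edges M)) \<and>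
      (\<forall>a\<in>Q. \<forall>b\<in>{}. {undefined, a} \<in> missing_edges M \<and> {undefined, b} \<notin> missing_edges M \<longrightarrow> c {undefined, a} \<noteq> c {undefined, b})"
      by (rule split_join_colouring[OF fin(1) finSL QSL m B(1-4)]) (use B(6) in auto)
    then show thesis using that by (elim exE conjE)
  qed
  have clash: "s = j r \<and> (a \<in> U0 \<longleftrightarrow> b \<notin> U0)"
    if "s \<in> SL" "a \<in> Q" "b \<in> Q" "a \<noteq> b" "c {s, a} = c {s, b}" for s a b
  proof -
    have "{s, a} \<in> missing_edges M \<longleftrightarrow> {s, b} \<notin> missing_edges M" using c(3) that by blast
    then have "(s, a) \<in> M \<longleftrightarrow> (s, b) \<notin> M" using B(5) that by blast
    then show ?thesis by (auto simp: M_def)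
  qed
  define A where "A = {b \<in> Q - U0. \<exists>a\<in>U0. c {j r, a} = c {j r, b}}"
  have finA: "finite A" using fin(1) by (simp add: A_def)
  have "card A \<le> card U0"
  proof -
    have inj: "inj_on (\<lambda>b. c {j r, b}) A"
    proof (rule inj_onI, rule ccontr)
      fix a b assume ab: "a \<in> A" "b \<in> A" "c {j r, a} = c {j r, b}" "a \<noteq> b"
      then have "a \<in> Q" "b \<in> Q" "a \<notin> U0" "b \<notin> U0" by (auto simp: A_def)
      then show False using clash[OF jr(1), of a b] ab by blast
    qed
    have "card A = card ((\<lambda>b. c {j r, b}) ` A)" by (rule card_image[OF inj, symmetric])
    also have "\<dots> \<le> card ((\<lambda>a. c {j r, a}) ` U0)"
    proof (rule card_mono)
      show "(\<lambda>b. c {j r, b}) ` A \<subseteq> (\<lambda>a. c {j r, a}) ` U0"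
      proof (rule image_subsetI)
        fix b assume "b \<in> A"
        then obtain a where "a \<in> U0" "c {j r, b} = c {j r, a}" unfolding A_def by force
        then show "c {j r, b} \<in> (\<lambda>a. c {j r, a}) ` U0" by (simp only: image_eqI)
      qed
    qed (use U0(3) in simp)
    also have "\<dots> \<le> card U0" using U0(3) by (rule card_image_le)
    finally show ?thesis .
  qed
  then have "card A \<le> card (Q - U)" using U(4) U0(2) by simp
  then obtain X where X: "X \<subseteq> Q - U" "card X = card A" using obtain_subset_with_card_n by metis
  have "X \<subseteq> Q - U0" "A \<subseteq> Q - U0" using X(1) U0(1) by (auto simp: A_def)
  then obtain \<pi> where \<pi>: "bij_betw \<pi> Q Q" "\<And>v. v \<in> Q \<Longrightarrow> \<pi> v \<in> U0 \<longleftrightarrow> v \<in> U0"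
    "\<And>v. v \<in> Q \<Longrightarrow> \<pi> v \<in> A \<Longrightarrow> v \<in> X"
    using permutation_moving[OF fin(1) H(1) _ _ X(2)] by blast
  have \<pi>Q: "\<pi> v \<in> Q" if "v \<in> Q" for v using \<pi>(1) that by (auto simp: bij_betw_def)
  show ?thesis
  proof (rule colouring_by_identification[OF QSL \<pi>(1), of "identify j"])
    fix s a b assume s: "s \<in> S" and ab: "a \<in> N s" "b \<in> N s" "a \<noteq> b"
    have abQ: "a \<in> Q" "b \<in> Q" using ab nbrs_Q[OF s] by auto
    have t: "identify j s \<in> SL" using identify_props(1)[OF j s] ab by blast
    show "c {identify j s, \<pi> a} \<noteq> c {identify j s, \<pi> b}"
    proof
      assume eq: "c {identify j s, \<pi> a} = c {identify j s, \<pi> b}"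
      have "\<pi> a \<noteq> \<pi> b" using \<pi>(1) abQ ab(3) by (auto simp: bij_betw_def inj_on_eq_iff)
      then have ts: "identify j s = j r" and U0ab: "\<pi> a \<in> U0 \<longleftrightarrow> \<pi> b \<notin> U0"
        using clash[OF t \<pi>Q[OF abQ(1)] \<pi>Q[OF abQ(2)] _ eq] by auto
      show False
      proof (cases "s \<in> SL")
        case True
        then have "s = j r" using ts by (simp add: identify_def)
        then have "a \<notin> U0" "b \<notin> U0" using ab U U0(1) by auto
        then show False using U0ab \<pi>(2) abQ by blast
      next
        case False
        then have "s \<in> SR - SL" using s ab nbrs_R[OF s] by (auto simp: SR_def)
        moreover have "j s = j r" using ts False by (simp add: identify_def)
        ultimately have "s = r" using inj_onD[OF j(1)] r(1) by blast
        then have "a \<notin> X" "b \<notin> X" using ab U(1) X(1) by auto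
        then have "\<pi> a \<notin> A" "\<pi> b \<notin> A" using \<pi>(3) abQ by blast+
        then show False using U0ab eq[unfolded ts] \<pi>Q abQ unfolding A_def by force
      qed
    qed
  qed (use identify_props[OF j] c in auto)
qed

text \<open>
  Pairs are deleted at the representing vertices first, all non-neighbours of one vertex before the next vertex. At
  most one representing vertex \<open>k\<close> is then served partially, and it is handled by the restricted greedy
  colouring. That stays affordable because the non-neighbourhoods of the representing vertices form a chain, so
  the clique vertices involved number at most \<open>x\<close>.
\<close>
lemma colouring_large_left_neighbourhoods:
  assumes j: "inj_on j (SR - SL)" "j ` (SR - SL) \<subseteq> SL - SR"
    and m: "card Q + card SL = 2 * m + 1"
    and x: "card Q + 2 * card SL = card SL * card SL + 1 + 2 * x"
    and total: "x \<le> (\<Sum>s\<in>SL. card (Q - N s))"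
    and small: "\<And>s. s \<in> SR - SL \<Longrightarrow> card (Q - N (j s)) \<le> x"
  shows "\<exists>col. proper_edge_colouring edges (2 * m) col"
proof -
  define F where "F s = Q - N s" for s
  define I where "I = j ` (SR - SL)"
  have finF: "finite (F s)" for s using fin(1) by (simp add: F_def)
  have I: "I \<subseteq> SL" "finite I" using j(2) finSR by (auto simp: I_def)
  have sub: "N s \<subseteq> F (j s)" if s: "s \<in> SR - SL" for s
  proof -
    have "s \<in> S" "s \<notin> SL" "j s \<in> S" "j s \<notin> SR" using s j(2) SR_sub SL_sub by auto
    then have "N s \<subseteq> R" "N (j s) \<subseteq> L" using nbrs_L nbrs_R by auto
    then show ?thesis using LR unfolding F_def by blast
  qed
  show ?thesis
  proof (cases "card (Sigma I F) \<le> x")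
    case True
    have "Sigma I F \<subseteq> Sigma SL F" using I(1) by blast
    moreover have "card (Sigma SL F) = (\<Sum>s\<in>SL. card (Q - N s))" using finSL finF by (simp add: F_def)
    moreover have "finite (Sigma SL F)" using finSL finF by simp
    ultimately obtain M where M: "Sigma I F \<subseteq> M" "M \<subseteq> Sigma SL F" "card M = x"
      using obtain_set_between[of "Sigma SL F" "Sigma I F" x] True total by metis
    have finM: "finite M" using M(2) finSL finF by (meson finite_SigmaI finite_subset)
    show ?thesis
    proof (rule colouring_from_missing_pairs[OF j m x _ M(3), of "snd ` M" "{}" undefined])
      show "M \<subseteq> SL \<times> Q" using M(2) by (auto simp: F_def)
      show "snd ` M \<subseteq> Q" using M(2) by (auto simp: F_def)
      show "card (snd ` M) \<le> x" using finM M(3) card_image_le by blast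
      show "\<And>s a. (s, a) \<in> M \<Longrightarrow> a \<notin> N s" using M(2) by (auto simp: F_def)
      fix s assume s: "s \<in> SR - SL"
      then have "(j s, a) \<in> M" if "a \<in> N s" for a using sub[OF s] M(1) that by (auto simp: I_def)
      then show "(\<forall>a\<in>N s. (j s, a) \<in> M) \<or> (\<forall>a\<in>N s. (j s, a) \<notin> M) \<or> j s = undefined \<and> N s \<subseteq> {}" by blast
    qed auto
  next
    case False
    then have "x < (\<Sum>s\<in>I. card (F s))" using I(2) finF by simp
    then obtain J k Y where J: "J \<subseteq> I" "k \<in> I - J" "Y \<subseteq> F k" "(\<Sum>s\<in>J. card (F s)) + card Y = x"
      using fill_up_to[OF I(2)] by metis
    define M where "M = Sigma J F \<union> {k} \<times> Y"
    have finJ: "finite J" "finite Y" using J I(2) finF finite_subset by blast+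
    have "card M = card (Sigma J F) + card ({k} \<times> Y)"
      unfolding M_def using finJ finF J(2) by (intro card_Un_disjoint) auto
    then have cardM: "card M = x" using J(4) finJ finF by (simp add: card_cartesian_product)
    have "F s \<subseteq> F t \<or> F t \<subseteq> F s" if "s \<in> I" "t \<in> I" for s t
    proof -
      have "s \<in> S" "t \<in> S" "s \<notin> SR" "t \<notin> SR" using that j(2) SL_sub by (auto simp: I_def)
      then have "N s \<subseteq> L" "N t \<subseteq> L" "N s \<inter> L \<subseteq> N t \<or> N t \<inter> L \<subseteq> N s"
        using nbrs_L chainL by auto
      then show ?thesis unfolding F_def by blast
    qed
    then obtain l where l: "l \<in> I" "\<forall>s\<in>I. F s \<subseteq> F l"
      using chain_has_greatest[OF I(2), of F] J(2) by blast
    have Fl: "card (F l) \<le> x" using l(1) small by (auto simp: I_def F_def)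
    have "k \<in> I" using J(2) by blast
    show ?thesis
    proof (rule colouring_from_missing_pairs[OF j m x _ cardM, of "F l" "F k" k])
      show "M \<subseteq> SL \<times> Q" using J I(1) by (auto simp: M_def F_def)
      show "F l \<subseteq> Q" by (auto simp: F_def)
      have MI: "M \<subseteq> Sigma I F" using J \<open>k \<in> I\<close> unfolding M_def by blast
      show "snd ` M \<subseteq> F l"
      proof (rule image_subsetI)
        fix p assume "p \<in> M"
        then obtain s a where "p = (s, a)" "s \<in> I" "a \<in> F s" using MI by blast
        then show "snd p \<in> F l" using l(2) by auto
      qed
      show "card (F l) \<le> x" by (rule Fl)
      show "\<And>s a. (s, a) \<in> M \<Longrightarrow> a \<notin> N s" using J(3) by (auto simp: M_def F_def)
      show "F k \<subseteq> F l" using l(2) \<open>k \<in> I\<close> by blast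
      show "k \<in> SL" using \<open>k \<in> I\<close> I(1) by blast
      fix s assume s: "s \<in> SR - SL"
      show "(\<forall>a\<in>N s. (j s, a) \<in> M) \<or> (\<forall>a\<in>N s. (j s, a) \<notin> M) \<or> j s = k \<and> N s \<subseteq> F k"
      proof (cases "j s = k")
        case True then show ?thesis using sub[OF s] by simp
      next
        case False
        then show ?thesis using sub[OF s] by (cases "j s \<in> J") (auto simp: M_def)
      qed
    qed
  qed
qed

end

section \<open>Colourings, degrees and the overfull neighbourhood\<close>

context two_chains
begin

text \<open>
  The assumptions say that the subgraphs induced by \<open>Q \<union> SL\<close> and, if it has the same maximum degree,
  by \<open>Q \<union> SR\<close> are not overfull.
\<close>
lemma colouring_even_degree:
  assumes le: "card SR \<le> card SL" and m: "card Q + card SL = 2 * m + 1"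
    and left: "card Q + 2 * card SL \<le> card SL * card SL + 1 + 2 * (\<Sum>s\<in>SL. card (Q - N s))"
    and right: "card SR = card SL \<Longrightarrow>
      card Q + 2 * card SR \<le> card SR * card SR + 1 + 2 * (\<Sum>s\<in>SR. card (Q - N s))"
  shows "\<exists>col. proper_edge_colouring edges (2 * m) col"
proof -
  obtain j where j: "inj_on j (SR - SL)" "j ` (SR - SL) \<subseteq> SL - SR"
    using identification_exists[OF le] .
  show ?thesis
  proof (cases "card Q + 2 * card SL \<le> card SL * card SL + 1")
    case True then show ?thesis using colouring_many_stable_vertices[OF j m] by blast
  next
    case False
    have "even (card Q + 2 * card SL + (card SL * card SL + 1))"
    proof -
      have "odd (card Q + card SL)" using m by simp
      then show ?thesis by auto
    qed
    then have "even (card Q + 2 * card SL - (card SL * card SL + 1))" using False by simp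
    then obtain x where "card Q + 2 * card SL - (card SL * card SL + 1) = 2 * x" by (elim evenE)
    then have x: "card Q + 2 * card SL = card SL * card SL + 1 + 2 * x" using False by linarith
    have x2: "2 * x \<le> card Q"
    proof -
      have "2 * card SL \<le> card SL * card SL + 1" by (cases "card SL"; cases "card SL - 1") auto
      then show ?thesis using x by linarith
    qed
    have card_co: "card (Q - N s) + card (N s) = card Q" if "s \<in> S" for s
      using nbrs_Q[OF that] fin(1) by (metis add.commute card_Diff_subset card_mono finite_subset le_add_diff_inverse)
    consider (balanced) r where "r \<in> SR - SL" "card (N (j r)) + x \<le> card Q" "card (N r) + x \<le> card Q"
      | (left) "\<forall>s\<in>SR - SL. card (Q - N (j s)) \<le> x"
      | (right) r where "r \<in> SR - SL" "x < card (Q - N (j r))"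
          "\<forall>s\<in>SR - SL. card Q < card (N s) + x \<or> card Q < card (N (j s)) + x"
      by (meson not_le)
    then show ?thesis
    proof cases
      case balanced then show ?thesis using colouring_one_stable_vertex[OF j m x] by blast
    next
      case left
      have "x \<le> (\<Sum>s\<in>SL. card (Q - N s))" using assms(3) x by linarith
      then show ?thesis using colouring_large_left_neighbourhoods[OF j m x] left by blast
    next
      case right
      \<comment> \<open>\<open>N r\<close> leaves little room for \<open>L\<close>, so all of \<open>SL - SR\<close> have small neighbourhoods and, as none is balanced, all of \<open>SR - SL\<close> large ones\<close>
      have jr: "j r \<in> S" "r \<in> S" "r \<notin> SL" using right(1) j(2) SL_sub SR_sub by auto
      have "card (N r) + x > card Q" using right(3)[rule_format, OF right(1)] right(2) card_co[OF jr(1)] by linarith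
      moreover have "card L + card (N r) \<le> card Q"
      proof -
        have "N r \<subseteq> R" using nbrs_R jr by blast
        then have sub: "L \<union> N r \<subseteq> Q" and disj: "L \<inter> N r = {}" using LR by blast+
        have "finite L" "finite (N r)" using sub fin(1) by (auto intro: finite_subset)
        then have "card (L \<union> N r) = card L + card (N r)" using disj by (rule card_Un_disjoint)
        moreover have "card (L \<union> N r) \<le> card Q" using fin(1) sub by (rule card_mono)
        ultimately show ?thesis by simp
      qed
      ultimately have Lx: "card L < x" by linarith
      have smallN: "card (N s) < x" if "s \<in> SL - SR" for s
      proof -
        have "N s \<subseteq> L" using that nbrs_L SL_sub by blast
        then have "card (N s) \<le> card L" by (rule card_mono[OF finite_subset[OF LR(1) fin(1)]])
        then show ?thesis using Lx by linarith
      qed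
      have largeN: "card (Q - N s) < x" if "s \<in> SR - SL" for s
      proof -
        have "j s \<in> SL - SR" "s \<in> S" using that j(2) SR_sub by auto
        then have "\<not> card Q < card (N (j s)) + x" using smallN[of "j s"] x2 by linarith
        then have "card Q < card (N s) + x" using right(3) that by blast
        then show ?thesis using card_co[OF \<open>s \<in> S\<close>] by linarith
      qed
      show ?thesis
      proof (cases "card SR = card SL")
        case True
        interpret M: two_chains Q S N R L by (rule mirror)
        have SL': "M.SL = SR" and SR': "M.SR = SL"
          by (simp_all add: M.SL_def M.SR_def SL_def SR_def)
        obtain j' where j': "inj_on j' (SL - SR)" "j' ` (SL - SR) \<subseteq> SR - SL"
          using M.identification_exists True unfolding SL' SR' by auto
        have "\<exists>col. proper_edge_colouring M.edges (2 * m) col"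
        proof (rule M.colouring_large_left_neighbourhoods[where j = j' and x = x])
          show "x \<le> (\<Sum>s\<in>M.SL. card (Q - N s))" using assms(4)[OF True] x True unfolding SL' by simp
          show "\<And>s. s \<in> M.SR - M.SL \<Longrightarrow> card (Q - N (j' s)) \<le> x"
            using j'(2) largeN unfolding SL' SR' by (meson image_subset_iff less_imp_le)
        qed (use j' m x True in \<open>simp_all add: SL' SR'\<close>)
        then show ?thesis by (simp add: M.edges_def edges_def)
      next
        case False
        then have "card (SR - SL) < card (SL - SR)"
        proof -
          have "card (SR - SL) + card (SR \<inter> SL) = card SR" "card (SL - SR) + card (SR \<inter> SL) = card SL"
            using finSL finSR by (metis Int_commute add.commute card_Int_Diff)+
          then show ?thesis using False le by linarith
        qed
        then have "card (j ` (SR - SL)) < card (SL - SR)" using card_image[OF j(1)] by simp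
        then have "\<not> SL - SR \<subseteq> j ` (SR - SL)" using finSR by (meson card_mono finite_Diff finite_imageI not_le)
        then obtain l where l: "l \<in> SL - SR" "l \<notin> j ` (SR - SL)" by blast
        have "x \<le> card (Q - N l)" 
        proof -
          have "l \<in> S" using l(1) SL_sub by blast
          then show ?thesis using smallN[OF l(1)] card_co[of l] x2 by linarith
        qed
        then obtain U where U: "U \<subseteq> Q - N l" "card U = x" using obtain_subset_with_card_n by metis
        show ?thesis
        proof (rule colouring_from_missing_pairs[OF j m x, of "{l} \<times> U" U "{}" undefined])
          show "\<And>s. s \<in> SR - SL \<Longrightarrow> (\<forall>a\<in>N s. (j s, a) \<in> {l} \<times> U) \<or> (\<forall>a\<in>N s. (j s, a) \<notin> {l} \<times> U) \<or>
              j s = undefined \<and> N s \<subseteq> {}" using l(2) by blast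
        qed (use l U in \<open>auto simp: card_cartesian_product\<close>)
      qed
    qed
  qed
qed

lemma colouring_from_complete_graph:
  fixes c :: "'a set \<Rightarrow> nat"
  assumes le: "card SR \<le> card SL"
    and c: "\<And>u z. u \<in> Q \<union> SL \<Longrightarrow> z \<in> Q \<union> SL - {u} \<Longrightarrow> c {u, z} < k"
      "\<And>u. u \<in> Q \<union> SL \<Longrightarrow> inj_on (\<lambda>z. c {u, z}) (Q \<union> SL - {u})"
  shows "\<exists>col. proper_edge_colouring edges k col"
proof -
  obtain j where j: "inj_on j (SR - SL)" "j ` (SR - SL) \<subseteq> SL - SR"
    using identification_exists[OF le] .
  have QSL: "Q \<inter> SL = {}" using QS SL_sub by blast
  show ?thesis
  proof (rule colouring_by_identification[OF QSL, of id "identify j" c])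
    fix s a b assume s: "s \<in> S" "a \<in> N s" "b \<in> N s" "a \<noteq> b"
    have t: "identify j s \<in> SL" using identify_props(1)[OF j s(1)] s(2) by blast
    then have u: "identify j s \<in> Q \<union> SL" by blast
    have "a \<in> Q" "b \<in> Q" using s nbrs_Q by auto
    then have "a \<in> Q \<union> SL - {identify j s}" "b \<in> Q \<union> SL - {identify j s}" using t QSL by auto
    then have "c {identify j s, a} \<noteq> c {identify j s, b}" using inj_onD[OF c(2)[OF u]] s(4) by blast
    then show "c {identify j s, id a} \<noteq> c {identify j s, id b}" by simp
  qed (use identify_props[OF j] c in auto)
qed

text \<open>
  With no prescribed colours at all, the extension lemma yields a 1-factorization of a complete graph of even
  order.
\<close>
lemma colouring_odd_degree:
  assumes "card SR \<le> card SL" "even (card Q + card SL)" "Q \<noteq> {}"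
  shows "\<exists>col. proper_edge_colouring edges (card Q + card SL - 1) col"
proof -
  let ?P = "Q \<union> SL"
  let ?k = "card Q + card SL - 1"
  have QSL: "Q \<inter> SL = {}" using QS SL_sub by blast
  have cardP: "card ?P = card Q + card SL" using fin(1) finSL QSL by (rule card_Un_disjoint)
  have pos: "0 < card Q" using assms(3) fin(1) card_gt_0_iff by blast
  have "\<exists>col. (\<forall>v\<in>?P. inj_on (\<lambda>z. col {v, z}) ({} \<union> ?P - {v}) \<and> (\<forall>z\<in>{} \<union> ?P - {v}. col {v, z} \<in> {..<?k})) \<and>
    (\<forall>w\<in>{}. inj_on (\<lambda>v. col {w, v}) ?P \<and> (\<forall>v\<in>?P. col {w, v} \<in> {}))"
    by (rule amalgamated_clique_colouring) (use fin(1) finSL cardP pos assms(2) in auto)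
  then obtain c :: "'a set \<Rightarrow> nat" where
    "\<forall>v\<in>?P. inj_on (\<lambda>z. c {v, z}) (?P - {v}) \<and> (\<forall>z\<in>?P - {v}. c {v, z} \<in> {..<?k})" by auto
  then show ?thesis by (intro colouring_from_complete_graph[OF assms(1), of c]) auto
qed

text \<open>
  Adding vertex numbers modulo the order colours any complete graph properly.
\<close>
lemma colouring_with_one_more_colour:
  assumes "card SR \<le> card SL"
  shows "\<exists>col. proper_edge_colouring edges (card Q + card SL) col"
proof -
  let ?P = "Q \<union> SL"
  let ?n = "card Q + card SL"
  have "Q \<inter> SL = {}" using QS SL_sub by blast
  then have cardP: "card ?P = ?n" using fin(1) finSL by (simp add: card_Un_disjoint)
  obtain f where f: "bij_betw f ?P {..<?n}"
    using finite_same_card_bij[of ?P "{..<?n}"] fin(1) finSL cardP by auto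
  define c where "c e = (\<Sum>v\<in>e. f v) mod ?n" for e
  have c2: "c {u, z} = (f u + f z) mod ?n" if "u \<noteq> z" for u z using that by (simp add: c_def)
  have flt: "f v < ?n" if "v \<in> ?P" for v using f that by (auto simp: bij_betw_def)
  show ?thesis
  proof (rule colouring_from_complete_graph[OF assms, of c])
    fix u assume u: "u \<in> ?P"
    show "inj_on (\<lambda>z. c {u, z}) (?P - {u})"
    proof (rule inj_onI)
      fix y z assume yz: "y \<in> ?P - {u}" "z \<in> ?P - {u}" "c {u, y} = c {u, z}"
      then have "(f u + f y) mod ?n = (f u + f z) mod ?n" using c2 by auto
      then have "?n dvd (f u + f y) - (f u + f z)" "?n dvd (f u + f z) - (f u + f y)"
        by (metis mod_eq_dvd_iff_nat diff_is_0_eq dvd_0_right nat_le_linear)+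
      then have "?n dvd f y - f z" "?n dvd f z - f y" by simp_all
      moreover have "f y - f z < ?n" "f z - f y < ?n" using flt[of y] flt[of z] yz by auto
      ultimately have "f y - f z = 0" "f z - f y = 0" by (meson nat_dvd_not_less not_gr_zero)+
      then have "f y = f z" by simp
      then show "y = z" using f yz by (auto simp: bij_betw_def inj_on_eq_iff)
    qed
    fix z assume "z \<in> ?P - {u}"
    then show "c {u, z} < ?n" 
      unfolding c_def using flt[OF u] by (intro mod_less_divisor) linarith
  qed
qed

lemma degree_edges:
  assumes "v \<in> Q \<union> S"
  shows "degree edges v = card {z. {v, z} \<in> edges}"
proof -
  have "{e \<in> edges. v \<in> e} = (\<lambda>z. {v, z}) ` {z. {v, z} \<in> edges}"
  proof (intro equalityI subsetI)
    fix e assume "e \<in> {e \<in> edges. v \<in> e}"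
    then have e: "e \<in> edges" "v \<in> e" by auto
    then obtain z where "e = {v, z}" using pair_at[OF subsetD[OF edges_sub]] by metis
    then show "e \<in> (\<lambda>z. {v, z}) ` {z. {v, z} \<in> edges}" using e by blast
  qed auto
  moreover have "inj_on (\<lambda>z. {v, z}) {z. {v, z} \<in> edges}" by (auto simp: inj_on_def doubleton_eq_iff)
  ultimately show ?thesis by (simp add: degree_def card_image)
qed

lemma degree_Q:
  assumes "u \<in> Q"
  shows "degree edges u = card Q - 1 + card {s \<in> S. u \<in> N s}"
proof -
  have "u \<notin> S" using assms QS by blast
  then have "{z. {u, z} \<in> edges} = (Q - {u}) \<union> {s \<in> S. u \<in> N s}"
    using assms unfolding edge_iff by blast
  moreover have "card ((Q - {u}) \<union> {s \<in> S. u \<in> N s}) = card (Q - {u}) + card {s \<in> S. u \<in> N s}"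
    using fin QS by (intro card_Un_disjoint) auto
  ultimately show ?thesis using degree_edges[of u] assms fin(1) by simp
qed

lemma degree_S:
  assumes "s \<in> S"
  shows "degree edges s = card (N s)"
proof -
  have "s \<notin> Q" "s \<notin> N t" if "t \<in> S" for t using assms QS nbrs_Q[OF that] by auto
  then have "{z. {s, z} \<in> edges} = N s" using assms unfolding edge_iff by blast
  then show ?thesis using degree_edges[of s] assms by simp
qed

text \<open>
  The least trace \<open>N s \<inter> L\<close> with \<open>s \<in> SL\<close> contains a vertex adjacent to all of \<open>SL\<close>, and no vertex has larger
  degree; stable vertices stay below because none is adjacent to all of \<open>Q\<close>.
\<close>
lemma max_degree_edges:
  assumes "card SR \<le> card SL" "Q \<noteq> {}" and proper: "\<And>s. s \<in> S \<Longrightarrow> N s \<noteq> Q"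
  shows "max_degree (Q \<union> S) edges = card Q - 1 + card SL"
  unfolding max_degree_def
proof (rule Max_eqI)
  show "finite (degree edges ` (Q \<union> S))" using fin by simp
  fix d assume "d \<in> degree edges ` (Q \<union> S)"
  then obtain v where v: "v \<in> Q \<union> S" "d = degree edges v" by blast
  show "d \<le> card Q - 1 + card SL"
  proof (cases "v \<in> Q")
    case True
    have "card {s \<in> S. v \<in> N s} \<le> card SL"
    proof (cases "v \<in> R")
      case True
      then have "card {s \<in> S. v \<in> N s} \<le> card SR" using finSR by (intro card_mono) (auto simp: SR_def)
      then show ?thesis using assms(1) by simp
    next
      case False
      then have "{s \<in> S. v \<in> N s} \<subseteq> SL" using nbrs unfolding SL_def by blast
      then show ?thesis using finSL by (intro card_mono) auto
    qed
    then show ?thesis using v(2) degree_Q[OF True] by simp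
  next
    case False
    then have "v \<in> S" using v by blast
    then have "N v \<subset> Q" using nbrs_Q proper by blast
    then have "card (N v) < card Q" using fin(1) by (intro psubset_card_mono)
    then show ?thesis using v(2) degree_S[OF \<open>v \<in> S\<close>] by simp
  qed
next
  have "\<exists>u\<in>Q. {s \<in> S. u \<in> N s} = SL"
  proof (cases "SL = {}")
    case True
    then have "SR = {}" using assms(1) finSR by simp
    then have "N s = {}" if "s \<in> S" for s using that True nbrs[OF that] unfolding SL_def SR_def by blast
    then show ?thesis using True assms(2) by auto
  next
    case False
    have "\<exists>k\<in>SL. \<forall>s\<in>SL. - (N s \<inter> L) \<subseteq> - (N k \<inter> L)"
      using chainL SL_sub by (intro chain_has_greatest[OF finSL False]) blast
    then obtain k where k: "k \<in> SL" "\<forall>s\<in>SL. N k \<inter> L \<subseteq> N s \<inter> L" by blast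
    then obtain u where u: "u \<in> N k" "u \<in> L" unfolding SL_def by blast
    have "{s \<in> S. u \<in> N s} = SL"
    proof
      show "{s \<in> S. u \<in> N s} \<subseteq> SL" using u by (auto simp: SL_def)
      show "SL \<subseteq> {s \<in> S. u \<in> N s}" using k u SL_sub by blast
    qed
    then show ?thesis using u(2) LR(1) by blast
  qed
  then obtain u where "u \<in> Q" "{s \<in> S. u \<in> N s} = SL" by blast
  then have "card Q - 1 + card SL = degree edges u" using degree_Q by simp
  then show "card Q - 1 + card SL \<in> degree edges ` (Q \<union> S)" using \<open>u \<in> Q\<close> by blast
qed

lemma card_edges: "card edges = card ([Q]\<^bsup>2\<^esup>) + (\<Sum>s\<in>S. card (N s))"
proof -
  have finN: "finite (N s)" if "s \<in> S" for s using nbrs_Q[OF that] fin(1) finite_subset by blast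
  have eq: "(\<Union>s\<in>S. (\<lambda>u. {s, u}) ` N s) = (\<lambda>(s, u). {s, u}) ` Sigma S N" by auto
  have inj: "inj_on (\<lambda>(s, u). {s, u}) (Sigma S N)"
  proof (rule inj_onI)
    fix p q assume pq: "p \<in> Sigma S N" "q \<in> Sigma S N" "(case p of (s, u) \<Rightarrow> {s, u}) = (case q of (s, u) \<Rightarrow> {s, u})"
    obtain s a t b where st: "p = (s, a)" "q = (t, b)" by (cases p; cases q)
    then have "s \<in> S" "t \<in> S" "a \<in> Q" "b \<in> Q" using pq nbrs_Q by auto
    then show "p = q" using pq(3) QS st by (auto simp: doubleton_eq_iff)
  qed
  have disj: "[Q]\<^bsup>2\<^esup> \<inter> (\<Union>s\<in>S. (\<lambda>u. {s, u}) ` N s) = {}"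
  proof -
    have "{s, u} \<notin> [Q]\<^bsup>2\<^esup>" if "s \<in> S" for s u using that QS by auto
    then show ?thesis by blast
  qed
  have "card (\<Union>s\<in>S. (\<lambda>u. {s, u}) ` N s) = (\<Sum>s\<in>S. card (N s))"
    unfolding eq using card_image[OF inj] fin(2) finN by (simp add: card_SigmaI)
  moreover have "finite (\<Union>s\<in>S. (\<lambda>u. {s, u}) ` N s)" using fin(2) finN by blast
  ultimately show ?thesis
    unfolding edges_def using card_Un_disjoint[OF finite_imp_finite_nsets[OF fin(1)] _ disj] by simp
qed

text \<open>
  The overfull subgraph is induced by \<open>Q \<union> SL\<close>, the closed neighbourhood of a vertex of maximum degree. It is of the same
  shape as the whole graph, so its maximum degree comes from \<open>max_degree_edges\<close> again.
\<close>
lemma overfull_neighbourhood: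
  assumes "Q \<noteq> {}" and proper: "\<And>s. s \<in> S \<Longrightarrow> N s \<noteq> Q"
    and md: "max_degree (Q \<union> S) edges = card Q - 1 + card SL" and odd: "odd (card Q + card SL)"
    and few: "card SL * card SL + 1 + 2 * (\<Sum>s\<in>SL. card (Q - N s)) < card Q + 2 * card SL"
  shows "subgraph_overfull (Q \<union> S) edges"
proof -
  interpret H: two_chains Q SL N L R
  proof
    show "N s \<subseteq> L \<union> R" if "s \<in> SL" for s using that SL_sub nbrs by blast
    show "N s \<inter> L \<subseteq> N t \<or> N t \<inter> L \<subseteq> N s" if "s \<in> SL" "t \<in> SL" for s t
      using that SL_sub by (intro chainL) auto
    show "N s \<inter> R \<subseteq> N t \<or> N t \<inter> R \<subseteq> N s" if "s \<in> SL" "t \<in> SL" for s t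
      using that SL_sub by (intro chainR) auto
  qed (use fin(1) finSL QS SL_sub LR in auto)
  have "H.SL = {s \<in> SL. N s \<inter> L \<noteq> {}}" by (rule H.SL_def)
  also have "\<dots> = SL" unfolding SL_def by blast
  finally have HSL: "H.SL = SL" .
  have QSL: "Q \<inter> SL = {}" using QS SL_sub by blast
  have "H.SR \<subseteq> SL" by (rule H.SR_sub)
  then have "card H.SR \<le> card SL" by (rule card_mono[OF finSL])
  then have mdH: "max_degree (Q \<union> SL) H.edges = card Q - 1 + card SL"
    using H.max_degree_edges[OF _ assms(1)] proper SL_sub unfolding HSL by blast
  have cardW: "card (Q \<union> SL) = card Q + card SL" using fin(1) finSL QSL by (rule card_Un_disjoint)
  have "subgraph (Q \<union> SL) H.edges (Q \<union> S) edges"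
    unfolding subgraph_def simple_graph_def
    using fin(1) finSL H.edges_sub SL_sub by (auto simp: H.edges_def edges_def)
  moreover have "overfull (Q \<union> SL) H.edges"
  proof -
    have "card (Q - N s) + card (N s) = card Q" if "s \<in> SL" for s
      using nbrs_Q[of s] SL_sub that fin(1) by (metis add.commute card_Diff_subset card_mono finite_subset le_add_diff_inverse subsetD)
    then have "(\<Sum>s\<in>SL. card (Q - N s)) + (\<Sum>s\<in>SL. card (N s)) = card SL * card Q"
      by (simp flip: sum.distrib)
    then have sumr: "real (\<Sum>s\<in>SL. card (N s)) = real (card SL) * real (card Q) - real (\<Sum>s\<in>SL. card (Q - N s))"
    proof -
      have "real (\<Sum>s\<in>SL. card (Q - N s)) + real (\<Sum>s\<in>SL. card (N s)) = real (card SL * card Q)"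
        using \<open>_ = card SL * card Q\<close> by (simp only: of_nat_add[symmetric])
      then show ?thesis by simp
    qed
    have pairs: "2 * real (card ([Q]\<^bsup>2\<^esup>)) = real (card Q) * real (card Q) - real (card Q)"
      using arg_cong[OF card_all_pairs[OF fin(1)], of real] by simp
    have few': "real (card SL) * real (card SL) + 1 + 2 * real (\<Sum>s\<in>SL. card (Q - N s)) < real (card Q) + 2 * real (card SL)"
      using few by (metis (mono_tags) of_nat_1 of_nat_add of_nat_less_iff of_nat_mult of_nat_numeral)
    have pos: "1 \<le> card Q" using assms(1) fin(1) by (simp add: Suc_leI card_gt_0_iff)
    have "2 * real (card H.edges) = real (card Q) * real (card Q) - real (card Q)
        + 2 * (real (card SL) * real (card Q)) - 2 * real (\<Sum>s\<in>SL. card (Q - N s))"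
      using H.card_edges pairs sumr by simp
    moreover have "(real (card (Q \<union> SL)) - 1) * real (max_degree (Q \<union> SL) H.edges)
      = real (card Q) * real (card Q) + real (card SL) * real (card SL) + 1
        + 2 * (real (card SL) * real (card Q)) - 2 * real (card Q) - 2 * real (card SL)"
      unfolding mdH cardW using pos by (simp add: of_nat_diff algebra_simps)
    ultimately show ?thesis unfolding overfull_def using few' odd cardW by simp
  qed
  ultimately show ?thesis
    unfolding subgraph_overfull_def using mdH md by metis
qed

end

section \<open>Split-comparability graphs\<close>

text \<open>
  A matching in a graph of odd order \<open>2 * w + 1\<close> has at most \<open>w\<close> edges.
\<close>
lemma overfull_not_colourable:
  assumes "subgraph W F V E" "max_degree W F = k" "overfull W F" "proper_edge_colouring E k c"
  shows False
proof -
  have finW: "finite W" and FW: "F \<subseteq> [W]\<^bsup>2\<^esup>" and FE: "F \<subseteq> E"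
    using assms(1) by (auto simp: subgraph_def simple_graph_def)
  have finF: "finite F" using FW finite_imp_finite_nsets[OF finW] finite_subset by blast
  obtain w where w: "card W = 2 * w + 1" using assms(3) by (auto simp: overfull_def elim: oddE)
  have cF: "c ` F \<subseteq> {..<k}" using assms(4) FE by (auto simp: proper_edge_colouring_def)
  have "card {e \<in> F. c e = i} \<le> w" for i
  proof -
    let ?M = "{e \<in> F. c e = i}"
    have "card (\<Union>?M) = (\<Sum>e\<in>?M. card e)"
    proof (rule card_Union_disjoint)
      show "pairwise disjnt ?M"
        using assms(4) FE unfolding pairwise_def disjnt_def proper_edge_colouring_def by blast
      show "\<And>e. e \<in> ?M \<Longrightarrow> finite e" using FW by (auto simp: nsets_def)
    qed
    also have "\<dots> = (\<Sum>e\<in>?M. 2)" using FW by (intro sum.cong) (auto simp: nsets_def)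
    finally have "card (\<Union>?M) = 2 * card ?M" by simp
    moreover have "\<Union>?M \<subseteq> W" using FW by (auto simp: nsets_def)
    then have "card (\<Union>?M) \<le> card W" by (rule card_mono[OF finW])
    ultimately show ?thesis using w by linarith
  qed
  then have "(\<Sum>i<k. card {e \<in> F. c e = i}) \<le> (\<Sum>i<k. w)" by (intro sum_mono)
  moreover have "card F = (\<Sum>i<k. card {e \<in> F. c e = i})"
  proof -
    have "card F = card (\<Union>i<k. {e \<in> F. c e = i})"
      using cF by (intro arg_cong[of _ _ card]) auto
    also have "\<dots> = (\<Sum>i<k. card {e \<in> F. c e = i})" using finF by (intro card_UN_disjoint) auto
    finally show ?thesis .
  qed
  ultimately have "card F \<le> k * w" by simp
  then have "real (card F) \<le> real k * real w" by (metis of_nat_le_iff of_nat_mult)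
  moreover have "real (card F) > (real (card W) - 1) * real k / 2"
    using assms(2,3) by (simp add: overfull_def)
  ultimately show False using w by (simp add: field_simps)
qed

lemma proper_edge_colouring_mono:
  assumes "proper_edge_colouring E k c" "k \<le> l"
  shows "proper_edge_colouring E l c"
proof -
  have "{..<k} \<subseteq> {..<l}" using assms(2) by simp
  then have "c ` E \<subseteq> {..<l}"
    using assms(1) unfolding proper_edge_colouring_def by (elim conjE) (rule subset_trans)
  moreover have "\<forall>e\<in>E. \<forall>f\<in>E. e \<noteq> f \<and> e \<inter> f \<noteq> {} \<longrightarrow> c e \<noteq> c f"
    using assms(1) unfolding proper_edge_colouring_def by (rule conjunct2)
  ultimately show ?thesis unfolding proper_edge_colouring_def by (rule conjI)
qed

lemma class_2_iff:
  assumes "proper_edge_colouring E (max_degree V E + 1) c"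
  shows "class_2 V E \<longleftrightarrow> \<not> (\<exists>c. proper_edge_colouring E (max_degree V E) c)"
proof
  assume "class_2 V E"
  then have "chromatic_index E = max_degree V E + 1" by (simp add: class_2_def)
  then show "\<not> (\<exists>c. proper_edge_colouring E (max_degree V E) c)"
    unfolding chromatic_index_def by (metis Suc_eq_plus1 lessI not_less_Least)
next
  assume none: "\<not> (\<exists>c. proper_edge_colouring E (max_degree V E) c)"
  have "chromatic_index E = max_degree V E + 1"
    unfolding chromatic_index_def
  proof (rule Least_equality)
    show "\<exists>c. proper_edge_colouring E (max_degree V E + 1) c" using assms by blast
    fix k assume "\<exists>c. proper_edge_colouring E k c"
    then show "max_degree V E + 1 \<le> k"
      using none proper_edge_colouring_mono by (metis Suc_eq_plus1 not_less_eq_eq)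
  qed
  then show "class_2 V E" by (simp add: class_2_def)
qed

context two_chains
begin

lemma class_2_iff_subgraph_overfull:
  assumes le: "card SR \<le> card SL" and "Q \<noteq> {}" and proper: "\<And>s. s \<in> S \<Longrightarrow> N s \<noteq> Q"
  shows "class_2 (Q \<union> S) edges \<longleftrightarrow> subgraph_overfull (Q \<union> S) edges"
proof -
  let ?D = "max_degree (Q \<union> S) edges"
  have md: "?D = card Q - 1 + card SL" by (rule max_degree_edges[OF assms])
  have pos: "0 < card Q" using assms(2) fin(1) card_gt_0_iff by blast
  have more: "\<exists>c. proper_edge_colouring edges (?D + 1) c"
    using colouring_with_one_more_colour[OF le] md pos by simp
  then have iff: "class_2 (Q \<union> S) edges \<longleftrightarrow> \<not> (\<exists>c. proper_edge_colouring edges ?D c)"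
    using class_2_iff by blast
  have "\<exists>c. proper_edge_colouring edges ?D c" if none: "\<not> subgraph_overfull (Q \<union> S) edges"
  proof (cases "even (card Q + card SL)")
    case True
    then show ?thesis using colouring_odd_degree[OF le True assms(2)] md pos by simp
  next
    case False
    then obtain m where m: "card Q + card SL = 2 * m + 1" by (elim oddE)
    have left: "card Q + 2 * card SL \<le> card SL * card SL + 1 + 2 * (\<Sum>s\<in>SL. card (Q - N s))"
      using overfull_neighbourhood[OF assms(2) proper md False] none by (meson not_le)
    have right: "card Q + 2 * card SR \<le> card SR * card SR + 1 + 2 * (\<Sum>s\<in>SR. card (Q - N s))"
      if eq: "card SR = card SL"
    proof -
      interpret M: two_chains Q S N R L by (rule mirror)
      have SL': "M.SL = SR" by (simp add: M.SL_def SR_def)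
      have "max_degree (Q \<union> S) edges = card Q - 1 + card M.SL" "odd (card Q + card M.SL)"
        unfolding SL' eq by (fact md, fact False)
      then have "\<not> card M.SL * card M.SL + 1 + 2 * (\<Sum>s\<in>M.SL. card (Q - N s)) < card Q + 2 * card M.SL"
        using M.overfull_neighbourhood[OF assms(2) proper] none by blast
      then show ?thesis unfolding SL' by (rule leI)
    qed
    have "\<exists>c. proper_edge_colouring edges (2 * m) c" by (rule colouring_even_degree[OF le m left right])
    moreover have "?D = 2 * m" using md m pos by simp
    ultimately show ?thesis by simp
  qed
  then show ?thesis
    using iff overfull_not_colourable unfolding subgraph_overfull_def by metis
qed

end

text \<open>
  If \<open>u \<rightarrow> s\<close> and \<open>v \<rightarrow> t\<close> with \<open>u\<close> and \<open>v\<close> in the clique, the arc between \<open>u\<close> and \<open>v\<close> composes with one of these to give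
  \<open>u \<rightarrow> t\<close> or \<open>v \<rightarrow> s\<close>; this yields the chain on \<open>L\<close>, and reversing arcs the one on \<open>R\<close>. A vertex in both
  \<open>L\<close> and \<open>R\<close> would produce an arc inside \<open>S\<close>.
\<close>
lemma two_chains_of_transitive_orientation:
  assumes "finite Q" "finite S" "Q \<inter> S = {}" "clique Q E" "indep S E" "orientation E A" "trans A"
  shows "two_chains Q S (\<lambda>s. {u \<in> Q. {s, u} \<in> E}) {u \<in> Q. \<exists>s\<in>S. (u, s) \<in> A} {u \<in> Q. \<exists>s\<in>S. (s, u) \<in> A}"
proof -
  have asym: "(x, y) \<in> A \<Longrightarrow> (y, x) \<notin> A" for x y
    using assms(6) by (auto simp: orientation_def dest: asymD)
  have E: "{x, y} \<in> E \<longleftrightarrow> (x, y) \<in> A \<or> (y, x) \<in> A" for x y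
    using assms(6) by (simp add: orientation_def)
  have tr: "(x, y) \<in> A \<Longrightarrow> (y, z) \<in> A \<Longrightarrow> (x, z) \<in> A" for x y z
    using assms(7) by (rule transD)
  have ind: "(s, t) \<notin> A" if "s \<in> S" "t \<in> S" for s t
    using assms(5) E[of s t] asym[of s t] that by (cases "s = t") (auto simp: indep_def)
  have sep: False if "s \<in> S" "t \<in> S" "(s, u) \<in> A" "(u, t) \<in> A" for s t u
    using tr[OF that(3,4)] ind that(1,2) by blast
  have total: "(u, v) \<in> A \<or> (v, u) \<in> A" if "u \<in> Q" "v \<in> Q" "u \<noteq> v" for u v
    using assms(4) that E by (auto simp: clique_def)
  have left: "(u, t) \<in> A \<or> (v, s) \<in> A" if "u \<in> Q" "v \<in> Q" "u \<noteq> v" "(u, s) \<in> A" "(v, t) \<in> A" for u v s t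
    using total[OF that(1-3)] tr that(4,5) by blast
  have right: "(t, u) \<in> A \<or> (s, v) \<in> A" if "u \<in> Q" "v \<in> Q" "u \<noteq> v" "(s, u) \<in> A" "(t, v) \<in> A" for u v s t
    using total[OF that(1-3)] tr that(4,5) by blast
  show ?thesis
  proof
    show "{u \<in> Q. \<exists>s\<in>S. (u, s) \<in> A} \<inter> {u \<in> Q. \<exists>s\<in>S. (s, u) \<in> A} = {}" using sep by blast
    show "{u \<in> Q. {s, u} \<in> E} \<subseteq> {u \<in> Q. \<exists>s\<in>S. (u, s) \<in> A} \<union> {u \<in> Q. \<exists>s\<in>S. (s, u) \<in> A}" if "s \<in> S" for s
      using that E by blast
  next
    fix s t assume st: "s \<in> S" "t \<in> S"
    let ?L = "{u \<in> Q. \<exists>s\<in>S. (u, s) \<in> A}" and ?R = "{u \<in> Q. \<exists>s\<in>S. (s, u) \<in> A}"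
    have L: "(u, s) \<in> A" if "s \<in> S" "u \<in> ?L" "{s, u} \<in> E" for s u using that E sep by blast
    have R: "(s, u) \<in> A" if "s \<in> S" "u \<in> ?R" "{s, u} \<in> E" for s u using that E sep by blast
    show "{u \<in> Q. {s, u} \<in> E} \<inter> ?L \<subseteq> {u \<in> Q. {t, u} \<in> E} \<or> {u \<in> Q. {t, u} \<in> E} \<inter> ?L \<subseteq> {u \<in> Q. {s, u} \<in> E}"
    proof (rule ccontr)
      assume "\<not> ?thesis"
      then obtain u v where uv: "u \<in> ?L" "{s, u} \<in> E" "{t, u} \<notin> E" "v \<in> ?L" "{t, v} \<in> E" "{s, v} \<notin> E" by blast
      then have "(u, s) \<in> A" "(v, t) \<in> A" "u \<noteq> v" "u \<in> Q" "v \<in> Q" using L st by blast+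
      then show False using left[of u v s t] uv E by blast
    qed
    show "{u \<in> Q. {s, u} \<in> E} \<inter> ?R \<subseteq> {u \<in> Q. {t, u} \<in> E} \<or> {u \<in> Q. {t, u} \<in> E} \<inter> ?R \<subseteq> {u \<in> Q. {s, u} \<in> E}"
    proof (rule ccontr)
      assume "\<not> ?thesis"
      then obtain u v where uv: "u \<in> ?R" "{s, u} \<in> E" "{t, u} \<notin> E" "v \<in> ?R" "{t, v} \<in> E" "{s, v} \<notin> E" by blast
      then have "(s, u) \<in> A" "(t, v) \<in> A" "u \<noteq> v" "u \<in> Q" "v \<in> Q" using R st by blast+
      then show False using right[of u v s t] uv E by blast
    qed
  qed (use assms(1-3) in auto)
qed

theorem mainTheorem2:
  fixes V Q S :: "'a set" and E :: "'a set set" and n :: nat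
  assumes "split_comparability_graph V E"
    and "n = card V"
    and "V = Q \<union> S" and "Q \<inter> S = {}"
    and "maximal_clique Q V E"
    and "indep S E"
    and "Q \<noteq> {}" and "S \<noteq> {}"
    and "real (max_degree V E) > real n / 3"
  shows "class_2 V E \<longleftrightarrow> subgraph_overfull V E"
proof -
  obtain A where A: "orientation E A" "trans A"
    using assms(1) by (auto simp: split_comparability_graph_def comparability_graph_def)
  have finV: "finite V" and EV: "E \<subseteq> [V]\<^bsup>2\<^esup>"
    using assms(1) by (auto simp: split_comparability_graph_def comparability_graph_def simple_graph_def)
  have fin: "finite Q" "finite S" using finV assms(3) by auto
  have clq: "clique Q E" and maxl: "\<not> (\<exists>R. R \<subseteq> V \<and> clique R E \<and> Q \<subset> R)"
    using assms(5) by (auto simp: maximal_clique_def)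
  define N where "N s = {u \<in> Q. {s, u} \<in> E}" for s
  define L where "L = {u \<in> Q. \<exists>s\<in>S. (u, s) \<in> A}"
  define R where "R = {u \<in> Q. \<exists>s\<in>S. (s, u) \<in> A}"
  interpret G: two_chains Q S N L R
    using two_chains_of_transitive_orientation[OF fin assms(4) clq assms(6) A]
    unfolding N_def L_def R_def .
  interpret M: two_chains Q S N R L by (rule G.mirror)
  have sw: "M.SL = G.SR" "M.SR = G.SL" by (simp_all add: M.SL_def M.SR_def G.SL_def G.SR_def)
  have proper: "N s \<noteq> Q" if "s \<in> S" for s
  proof
    assume "N s = Q"
    then have "{s, u} \<in> E" if "u \<in> Q" for u using that by (auto simp: N_def)
    then have "clique (insert s Q) E" using clq by (auto simp: clique_def insert_commute)
    moreover have "Q \<subset> insert s Q" "insert s Q \<subseteq> V" using that assms(3,4) by auto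
    ultimately show False using maxl by blast
  qed
  have edges: "G.edges = E"
  proof (intro equalityI subsetI)
    fix e assume "e \<in> G.edges"
    then show "e \<in> E" using clq by (auto simp: G.edges_def N_def clique_def nsets_2_eq)
  next
    fix e assume e: "e \<in> E"
    then have "e \<in> [V]\<^bsup>2\<^esup>" using EV by blast
    then obtain x y where xy: "e = {x, y}" "x \<in> V" "y \<in> V" "x \<noteq> y" by (auto simp: nsets_2_eq)
    have "\<not> (x \<in> S \<and> y \<in> S)" using e xy assms(6) by (auto simp: indep_def)
    then show "e \<in> G.edges"
      using xy e assms(3) unfolding xy(1) G.edge_iff N_def by (auto simp: insert_commute)
  qed
  show ?thesis
  proof (cases "card G.SR \<le> card G.SL")
    case True
    then show ?thesis using G.class_2_iff_subgraph_overfull[OF _ assms(7) proper] edges assms(3) by simp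
  next
    case False
    then have "card M.SR \<le> card M.SL" by (simp add: sw)
    then show ?thesis using M.class_2_iff_subgraph_overfull[OF _ assms(7) proper] edges assms(3) by simp
  qed
qed

end
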